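(* If $G$ is a one-ended, quasi-transitive graph, then the unique end of $G$ is thick.
   Context: A graph is quasi-transitive if its automorphism group has only finitely many orbits on the vertices. A ray is a one-way infinite path. Two rays of $G$ are in the same end if for every finite vertex set $S$ they have tails in the same component of $G-S$; ends are the equivalence classes, and $G$ is one-ended if it has exactly one end. The vertex degree of an end is the natural number $k$ if the maximal cardinality of a family of pairwise disjoint rays belonging to the end is $k$; if no such number exists the vertex degree is infinite. An end is thick if its vertex degree is infinite. *)

theory Defs
  imports Main "HOL-Library.Extended_Nat" "HOL-Library.Disjoint_Sets"
begin

text \<open>
  A graph is given by a vertex set \<open>V\<close> of arbitrary cardinality and an adjacency relation \<open>E\<close>.
  It is simple and undirected, but neither local finiteness nor connectedness is assumed.
\<close>

definition simple_graph :: "'a set \<Rightarrow> ('a \<Rightarrow> 'a \<Rightarrow> bool) \<Rightarrow> bool" where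
  "simple_graph V E \<longleftrightarrow>
     (\<forall>x y. E x y \<longrightarrow> x \<in> V \<and> y \<in> V) \<and> (\<forall>x y. E x y \<longrightarrow> E y x) \<and> (\<forall>x. \<not> E x x)"

text \<open>The values of an automorphism outside \<open>V\<close> are irrelevant and left unconstrained.\<close>

definition graph_automorphism :: "'a set \<Rightarrow> ('a \<Rightarrow> 'a \<Rightarrow> bool) \<Rightarrow> ('a \<Rightarrow> 'a) \<Rightarrow> bool" where
  "graph_automorphism V E f \<longleftrightarrow> bij_betw f V V \<and> (\<forall>x\<in>V. \<forall>y\<in>V. E (f x) (f y) \<longleftrightarrow> E x y)"

definition vertex_orbit :: "'a set \<Rightarrow> ('a \<Rightarrow> 'a \<Rightarrow> bool) \<Rightarrow> 'a \<Rightarrow> 'a set" where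
  "vertex_orbit V E x = {f x | f. graph_automorphism V E f}"

definition quasi_transitive :: "'a set \<Rightarrow> ('a \<Rightarrow> 'a \<Rightarrow> bool) \<Rightarrow> bool" where
  "quasi_transitive V E \<longleftrightarrow> finite (vertex_orbit V E ` V)"

text \<open>\<open>connected_in W E\<close> is connectivity in the subgraph induced by \<open>W\<close>.\<close>

definition connected_in :: "'a set \<Rightarrow> ('a \<Rightarrow> 'a \<Rightarrow> bool) \<Rightarrow> ('a \<times> 'a) set" where
  "connected_in W E =
     {(x, y). x \<in> W \<and> y \<in> W \<and> (\<lambda>u v. u \<in> W \<and> v \<in> W \<and> E u v)\<^sup>*\<^sup>* x y}"

definition components :: "'a set \<Rightarrow> ('a \<Rightarrow> 'a \<Rightarrow> bool) \<Rightarrow> 'a set set" where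
  "components W E = W // connected_in W E"

text \<open>
  A one-way infinite path has a unique vertex of degree one, its starting vertex, so it is the
  same thing as the injective sequence of its vertices.
\<close>

definition rays :: "'a set \<Rightarrow> ('a \<Rightarrow> 'a \<Rightarrow> bool) \<Rightarrow> (nat \<Rightarrow> 'a) set" where
  "rays V E = {R. range R \<subseteq> V \<and> inj R \<and> (\<forall>n. E (R n) (R (Suc n)))}"

definition end_equiv :: "'a set \<Rightarrow> ('a \<Rightarrow> 'a \<Rightarrow> bool) \<Rightarrow> ((nat \<Rightarrow> 'a) \<times> (nat \<Rightarrow> 'a)) set" where
  "end_equiv V E =
     {(R, Q). R \<in> rays V E \<and> Q \<in> rays V E \<and>
        (\<forall>S. finite S \<and> S \<subseteq> V \<longrightarrow>
          (\<exists>C \<in> components (V - S) E. \<exists>m n. R ` {m..} \<subseteq> C \<and> Q ` {n..} \<subseteq> C))}"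

definition ends :: "'a set \<Rightarrow> ('a \<Rightarrow> 'a \<Rightarrow> bool) \<Rightarrow> (nat \<Rightarrow> 'a) set set" where
  "ends V E = rays V E // end_equiv V E"

definition one_ended :: "'a set \<Rightarrow> ('a \<Rightarrow> 'a \<Rightarrow> bool) \<Rightarrow> bool" where
  "one_ended V E \<longleftrightarrow> (\<exists>!\<omega>. \<omega> \<in> ends V E)"

text \<open>An end is itself a set of rays, so the following notions need no reference to the graph.\<close>

definition disjoint_rays_in :: "(nat \<Rightarrow> 'a) set \<Rightarrow> (nat \<Rightarrow> 'a) set \<Rightarrow> bool" where
  "disjoint_rays_in \<omega> F \<longleftrightarrow> F \<subseteq> \<omega> \<and> disjoint_family_on range F"

definition has_vertex_degree :: "(nat \<Rightarrow> 'a) set \<Rightarrow> nat \<Rightarrow> bool" where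
  "has_vertex_degree \<omega> k \<longleftrightarrow>
     (\<exists>F. disjoint_rays_in \<omega> F \<and> finite F \<and> card F = k) \<and>
     (\<forall>F. disjoint_rays_in \<omega> F \<longrightarrow> finite F \<and> card F \<le> k)"

definition vertex_degree :: "(nat \<Rightarrow> 'a) set \<Rightarrow> enat" where
  "vertex_degree \<omega> =
     (if \<exists>k. has_vertex_degree \<omega> k then enat (THE k. has_vertex_degree \<omega> k) else \<infinity>)"

definition thick :: "(nat \<Rightarrow> 'a) set \<Rightarrow> bool" where
  "thick \<omega> \<longleftrightarrow> vertex_degree \<omega> = \<infinity>"

lemma has_vertex_degree_unique:
  "has_vertex_degree \<omega> k \<Longrightarrow> has_vertex_degree \<omega> l \<Longrightarrow> k = l"
  unfolding has_vertex_degree_def by (metis le_antisym)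

lemma vertex_degree_eq_enat_iff: "vertex_degree \<omega> = enat k \<longleftrightarrow> has_vertex_degree \<omega> k"
proof -
  have "(THE l. has_vertex_degree \<omega> l) = l" if "has_vertex_degree \<omega> l" for l
    using that by (rule the_equality) (rule has_vertex_degree_unique[OF _ that])
  then show ?thesis
    by (cases "\<exists>l. has_vertex_degree \<omega> l") (auto simp: vertex_degree_def)
qed

lemma equiv_connected_in:
  assumes "simple_graph V E"
  shows "equiv W (connected_in W E)"
proof -
  let ?r = "\<lambda>u v. u \<in> W \<and> v \<in> W \<and> E u v"
  have "symp ?r"
    using assms by (auto simp: simple_graph_def symp_def)
  then have "symp ?r\<^sup>*\<^sup>*"
    by (rule symp_rtranclp)
  then have "sym (connected_in W E)"
    by (auto simp: connected_in_def sym_def symp_def)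
  moreover have "trans (connected_in W E)"
    by (auto simp: connected_in_def trans_def)
  moreover have "refl_on W (connected_in W E)" "connected_in W E \<subseteq> W \<times> W"
    by (auto simp: connected_in_def refl_on_def)
  ultimately show ?thesis
    by (auto simp: equiv_def)
qed

lemma ray_has_tail_in_component:
  assumes "R \<in> rays V E" "finite S"
  shows "\<exists>C \<in> components (V - S) E. \<exists>m. R ` {m..} \<subseteq> C"
proof -
  have R: "range R \<subseteq> V" "inj R" "\<And>n. E (R n) (R (Suc n))"
    using assms(1) by (auto simp: rays_def)
  have "finite (R -` S)"
    using assms(2) R(2) by (rule finite_vimageI)
  then obtain m where m: "\<And>n. n \<in> R -` S \<Longrightarrow> n < m"
    by (auto simp: finite_nat_set_iff_bounded)
  have inW: "R n \<in> V - S" if "n \<ge> m" for n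
    using m[of n] that R(1) by auto
  have "(R m, R n) \<in> connected_in (V - S) E" if "n \<ge> m" for n
    using that
  proof (induction n rule: dec_induct)
    case base
    then show ?case using inW by (simp add: connected_in_def)
  next
    case (step n)
    then show ?case using inW[of n] inW[of "Suc n"] R(3)[of n]
      by (auto simp: connected_in_def intro: rtranclp.rtrancl_into_rtrancl)
  qed
  then have "R ` {m..} \<subseteq> connected_in (V - S) E `` {R m}"
    by auto
  moreover have "connected_in (V - S) E `` {R m} \<in> components (V - S) E"
    unfolding components_def using inW by (intro quotientI) auto
  ultimately show ?thesis by blast
qed

lemma end_equivI:
  assumes "R \<in> rays V E" "Q \<in> rays V E"
    and "\<And>S. finite S \<Longrightarrow> S \<subseteq> V \<Longrightarrow>
      \<exists>C \<in> components (V - S) E. \<exists>m n. R ` {m..} \<subseteq> C \<and> Q ` {n..} \<subseteq> C"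
  shows "(R, Q) \<in> end_equiv V E"
  using assms unfolding end_equiv_def mem_Collect_eq case_prod_conv by simp

lemma end_equivD:
  assumes "(R, Q) \<in> end_equiv V E"
  shows "R \<in> rays V E" "Q \<in> rays V E"
    and "finite S \<Longrightarrow> S \<subseteq> V \<Longrightarrow>
      \<exists>C \<in> components (V - S) E. \<exists>m n. R ` {m..} \<subseteq> C \<and> Q ` {n..} \<subseteq> C"
  using assms unfolding end_equiv_def mem_Collect_eq case_prod_conv by simp_all

lemma equiv_end_equiv:
  assumes "simple_graph V E"
  shows "equiv (rays V E) (end_equiv V E)"
proof -
  have "refl_on (rays V E) (end_equiv V E)"
  proof (rule refl_onI)
    fix R assume R: "R \<in> rays V E"
    show "(R, R) \<in> end_equiv V E"
    proof (rule end_equivI[OF R R])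
      fix S :: "'a set" assume "finite S"
      from ray_has_tail_in_component[OF R this]
      show "\<exists>C \<in> components (V - S) E. \<exists>m n. R ` {m..} \<subseteq> C \<and> R ` {n..} \<subseteq> C"
        by meson
    qed
  qed
  moreover have "sym (end_equiv V E)"
  proof (rule symI)
    fix R Q assume RQ: "(R, Q) \<in> end_equiv V E"
    show "(Q, R) \<in> end_equiv V E"
    proof (rule end_equivI[OF end_equivD(2,1)[OF RQ]])
      fix S :: "'a set" assume "finite S" "S \<subseteq> V"
      from end_equivD(3)[OF RQ this]
      show "\<exists>C \<in> components (V - S) E. \<exists>m n. Q ` {m..} \<subseteq> C \<and> R ` {n..} \<subseteq> C"
        by meson
    qed
  qed
  moreover have "trans (end_equiv V E)"
  proof (rule transI)
    fix R Q P assume RQ: "(R, Q) \<in> end_equiv V E" and QP: "(Q, P) \<in> end_equiv V E"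
    show "(R, P) \<in> end_equiv V E"
    proof (rule end_equivI[OF end_equivD(1)[OF RQ] end_equivD(2)[OF QP]])
      fix S assume S: "finite S" "S \<subseteq> V"
      obtain C m n where C: "C \<in> components (V - S) E" "R ` {m..} \<subseteq> C" "Q ` {n..} \<subseteq> C"
        using end_equivD(3)[OF RQ S] by meson
      obtain D m' n' where D: "D \<in> components (V - S) E" "Q ` {m'..} \<subseteq> D" "P ` {n'..} \<subseteq> D"
        using end_equivD(3)[OF QP S] by meson
      have "Q (max n m') \<in> C \<inter> D"
        using C(3) D(2) by auto
      then have "C = D"
        using quotient_disj[OF equiv_connected_in[OF assms] C(1)[unfolded components_def]
          D(1)[unfolded components_def]] by auto
      then show "\<exists>C \<in> components (V - S) E. \<exists>m n. R ` {m..} \<subseteq> C \<and> P ` {n..} \<subseteq> C"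
        using C D by meson
    qed
  qed
  moreover have "end_equiv V E \<subseteq> rays V E \<times> rays V E"
    by (intro subrelI SigmaI end_equivD(1,2))
  ultimately show ?thesis
    by (simp add: equiv_def)
qed

end

theory Submission
  imports Defs
begin

text \<open>
  Let \<open>n\<close> be given; \<open>n\<close> disjoint rays have to be found, since all rays belong to the only end.

  A vertex \<open>dominates\<close> the end if no finite set of other vertices separates it from the end. If there
  are infinitely many dominating vertices, any two of them are joined outside any finite set, and
  Menger's theorem (\<open>menger_linkage\<close>), applied again and again to fresh \<open>n\<close>-sets of dominating
  vertices, yields linkages that compose to \<open>n\<close> disjoint rays (\<open>disjoint_rays_from_linkages\<close>). If
  there are only finitely many, they form a set that is invariant under all automorphisms. Deleting it and
  passing to the component that contains tails of all rays leads to a connected one-ended graph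
  whose automorphisms still have finitely many orbits, now without dominating vertices.

  In such a graph every finite set \<open>X\<close> is cut off from the end, or \<open>enclosed\<close>, by a finite set
  disjoint from \<open>X\<close>. If some \<open>X\<close> cannot be enclosed by fewer than \<open>n\<close> vertices, a sequence of smallest
  enclosures, each one enclosing the previous one, is linked by Menger's theorem, and \<open>n\<close> disjoint
  rays arise (\<open>disjoint_rays_if_large_minimal\<close>). Otherwise there is a least \<open>k\<close> such that \<open>k\<close>
  vertices suffice to enclose any finite set; let \<open>X0\<close> be a set that fewer than \<open>k\<close> vertices do not enclose.
  Fix around every orbit representative nested enclosures \<open>T\<^sub>0\<close>, \<dots>, \<open>T\<^sub>k\<close> such that each
  \<open>T\<^sub>i\<close> is connected within the region that \<open>T\<^sub>i\<^sub>+\<^sub>1\<close>, but not \<open>T\<^sub>i\<close>, encloses and that contains \<open>T\<^sub>i\<close>. Let a set \<open>S\<close> of at most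
  \<open>k\<close> vertices enclose a connected finite set \<open>Y \<supseteq> X0\<close>, and translate these enclosures to a vertex of
  \<open>S\<close>. One of the \<open>k\<close> regions avoids \<open>S\<close>, so its \<open>T\<^sub>i\<close> lies on one side of \<open>S\<close>. Then the vertices of
  \<open>S\<close> inside \<open>T\<^sub>i\<close> are superfluous for enclosing \<open>Y\<close>, contrary to the choice of \<open>X0\<close>, unless \<open>T\<^sub>i\<close>
  itself encloses \<open>Y\<close>.

  Hence translates of the finitely many sets \<open>T\<^sub>i\<close> enclose every finite set, and so
  do the translates of a single one of them, \<open>T\<close>. A translate of \<open>T\<close> that encloses \<open>T\<close> gives an automorphism that
  maps \<open>T\<close> and all that \<open>T\<close> encloses into what \<open>T\<close> encloses. Its iterates produce a ray enclosed by
  \<open>T\<close> (\<open>no_contracting_automorphism\<close>), which is impossible as no tail of such a ray is on the side of the end.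
\<close>

section \<open>Connected vertex sets\<close>

text \<open>
  Nonempty connected sets serve as paths: of a path, only its vertex set matters for disjointness.
\<close>

definition connected_set :: "('a \<Rightarrow> 'a \<Rightarrow> bool) \<Rightarrow> 'a set \<Rightarrow> bool" where
  "connected_set E P \<longleftrightarrow> (\<forall>x\<in>P. \<forall>y\<in>P. (x, y) \<in> connected_in P E)"

lemma connected_in_memD: "(x, y) \<in> connected_in W E \<Longrightarrow> x \<in> W" "(x, y) \<in> connected_in W E \<Longrightarrow> y \<in> W"
  by (auto simp: connected_in_def)

lemma connected_in_refl: "x \<in> W \<Longrightarrow> (x, x) \<in> connected_in W E"
  by (auto simp: connected_in_def)

lemma connected_in_trans:
  "(x, y) \<in> connected_in W E \<Longrightarrow> (y, z) \<in> connected_in W E \<Longrightarrow> (x, z) \<in> connected_in W E"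
  by (auto simp: connected_in_def)

lemma connected_in_edge: "E x y \<Longrightarrow> x \<in> W \<Longrightarrow> y \<in> W \<Longrightarrow> (x, y) \<in> connected_in W E"
  by (auto simp: connected_in_def)

lemma connected_in_sym:
  assumes "symp E" "(x, y) \<in> connected_in W E"
  shows "(y, x) \<in> connected_in W E"
proof -
  have "symp (\<lambda>u v. u \<in> W \<and> v \<in> W \<and> E u v)"
    using assms(1) by (auto simp: symp_def)
  from symp_rtranclp[OF this] show ?thesis
    using assms(2) by (auto simp: connected_in_def symp_def)
qed

lemma connected_in_induct [consumes 1, case_names base step]:
  assumes "(x, y) \<in> connected_in W E"
    and "x \<in> W \<Longrightarrow> P x"
    and "\<And>u v. (x, u) \<in> connected_in W E \<Longrightarrow> u \<in> W \<Longrightarrow> v \<in> W \<Longrightarrow> E u v \<Longrightarrow> P u \<Longrightarrow> P v"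
  shows "P y"
proof -
  have "x \<in> W" and "(\<lambda>u v. u \<in> W \<and> v \<in> W \<and> E u v)\<^sup>*\<^sup>* x y"
    using assms(1) by (auto simp: connected_in_def)
  from this(2) show ?thesis
  proof (induction rule: rtranclp_induct)
    case base
    show ?case by (rule assms(2)[OF \<open>x \<in> W\<close>])
  next
    case (step u v)
    show ?case
      by (rule assms(3)[of u v]) (use step \<open>x \<in> W\<close> in \<open>auto simp: connected_in_def\<close>)
  qed
qed

lemma connected_in_mono:
  assumes "(x, y) \<in> connected_in W E" "W \<subseteq> W'" "\<And>u v. u \<in> W \<Longrightarrow> v \<in> W \<Longrightarrow> E u v \<Longrightarrow> E' u v"
  shows "(x, y) \<in> connected_in W' E'"
  using assms(1)
proof (induction rule: connected_in_induct)
  case base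
  then show ?case using assms(2) by (auto intro: connected_in_refl)
next
  case (step u v)
  then show ?case using assms(2,3)
    by (meson connected_in_edge connected_in_trans subsetD)
qed

text \<open>Most separation arguments below consist in exhibiting a set that no edge leaves.\<close>

lemma connected_in_closed:
  assumes "(x, y) \<in> connected_in W E" "x \<in> K"
    and "\<And>k u. k \<in> K \<Longrightarrow> k \<in> W \<Longrightarrow> u \<in> W \<Longrightarrow> E k u \<Longrightarrow> u \<in> K"
  shows "y \<in> K"
  using assms(1) by (induction rule: connected_in_induct) (use assms in auto)

lemma connected_in_reachable:
  assumes "(x, y) \<in> connected_in W E"
  shows "(x, y) \<in> connected_in {u. (x, u) \<in> connected_in W E} E"
  using assms
proof (induction rule: connected_in_induct)
  case base
  then show ?case by (auto intro: connected_in_refl)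
next
  case (step u v)
  have "(x, v) \<in> connected_in W E"
    using step by (meson connected_in_edge connected_in_trans)
  then show ?case using step
    by (intro connected_in_trans[OF step.IH] connected_in_edge) auto
qed

lemma connected_in_last_exit:
  assumes "(x, y) \<in> connected_in W E" "x \<noteq> y"
  shows "\<exists>u. E x u \<and> (u, y) \<in> connected_in (W - {x}) E"
proof -
  have "y = x \<or> (\<exists>u. E x u \<and> (u, y) \<in> connected_in (W - {x}) E)"
    using assms(1)
  proof (induction rule: connected_in_induct)
    case base
    then show ?case by simp
  next
    case (step u v)
    show ?case
    proof (cases "v = x \<or> u = x")
      case True
      then show ?thesis using step by (auto intro: connected_in_refl)
    next
      case False
      then obtain w where "E x w" "(w, u) \<in> connected_in (W - {x}) E"
        using step.IH by auto
      moreover have "(u, v) \<in> connected_in (W - {x}) E"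
        using False step by (intro connected_in_edge) auto
      ultimately show ?thesis by (meson connected_in_trans)
    qed
  qed
  then show ?thesis using assms(2) by auto
qed

lemma connected_setD: "connected_set E P \<Longrightarrow> x \<in> P \<Longrightarrow> y \<in> P \<Longrightarrow> (x, y) \<in> connected_in P E"
  by (auto simp: connected_set_def)

lemma connected_setI_root:
  assumes "symp E" "\<And>x. x \<in> P \<Longrightarrow> (r, x) \<in> connected_in P E"
  shows "connected_set E P"
  unfolding connected_set_def using assms by (meson connected_in_sym connected_in_trans)

lemma connected_set_subset_in:
  "connected_set E P \<Longrightarrow> P \<subseteq> W \<Longrightarrow> x \<in> P \<Longrightarrow> y \<in> P \<Longrightarrow> (x, y) \<in> connected_in W E"
  by (erule connected_in_mono[OF connected_setD]) auto

lemma connected_set_mono: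
  assumes "connected_set E P" "\<And>u v. E u v \<Longrightarrow> E' u v"
  shows "connected_set E' P"
  unfolding connected_set_def
proof (intro ballI)
  fix x y assume "x \<in> P" "y \<in> P"
  then have "(x, y) \<in> connected_in P E" by (rule connected_setD[OF assms(1)])
  then show "(x, y) \<in> connected_in P E'" by (rule connected_in_mono) (auto intro: assms(2))
qed

lemma connected_set_singleton: "connected_set E {x}"
  by (auto simp: connected_set_def intro: connected_in_refl)

lemma connected_set_UN:
  assumes "symp E" "\<And>i. i \<in> I \<Longrightarrow> connected_set E (P i)" "\<And>i. i \<in> I \<Longrightarrow> r \<in> P i"
  shows "connected_set E (\<Union>i\<in>I. P i)"
proof (rule connected_setI_root[OF assms(1)])
  fix x assume "x \<in> (\<Union>i\<in>I. P i)"
  then obtain i where "i \<in> I" "x \<in> P i" by auto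
  then show "(r, x) \<in> connected_in (\<Union>i\<in>I. P i) E"
    using assms by (intro connected_set_subset_in[of E "P i"]) auto
qed

lemma connected_set_Un_edge:
  assumes "symp E" "connected_set E P" "connected_set E Q" "x \<in> P" "y \<in> Q" "x = y \<or> E x y"
  shows "connected_set E (P \<union> Q)"
proof (rule connected_setI_root[OF assms(1)])
  fix z assume z: "z \<in> P \<union> Q"
  have xP: "(x, u) \<in> connected_in (P \<union> Q) E" if "u \<in> P" for u
    using that assms by (intro connected_set_subset_in[of E P]) auto
  have yQ: "(y, u) \<in> connected_in (P \<union> Q) E" if "u \<in> Q" for u
    using that assms by (intro connected_set_subset_in[of E Q]) auto
  have "(x, y) \<in> connected_in (P \<union> Q) E"
    using assms by (auto intro: connected_in_refl connected_in_edge)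
  then show "(x, z) \<in> connected_in (P \<union> Q) E"
    using z xP yQ by (meson UnE connected_in_trans)
qed

lemma connected_set_reachable:
  assumes "symp E"
  shows "connected_set E {u. (x, u) \<in> connected_in W E}"
  using assms by (rule connected_setI_root[of _ _ x]) (auto intro: connected_in_reachable)

lemma connected_in_finite_connected_set:
  assumes "symp E" "(x, y) \<in> connected_in W E"
  shows "\<exists>P. finite P \<and> P \<subseteq> W \<and> connected_set E P \<and> x \<in> P \<and> y \<in> P"
  using assms(2)
proof (induction rule: connected_in_induct)
  case base
  then show ?case by (intro exI[of _ "{x}"]) (auto simp: connected_set_singleton)
next
  case (step u v)
  then obtain P where "finite P" "P \<subseteq> W" "connected_set E P" "x \<in> P" "u \<in> P"
    by auto
  then show ?case using step assms(1)
    by (intro exI[of _ "P \<union> {v}"])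
       (auto intro!: connected_set_Un_edge[of E P "{v}" u v] connected_set_singleton
             simp del: Un_insert_right)
qed

lemma finite_connected_superset:
  assumes "symp E" "finite X" "X \<subseteq> W"
    and conn: "\<And>x y. x \<in> X \<Longrightarrow> y \<in> X \<Longrightarrow> (x, y) \<in> connected_in W E"
  shows "\<exists>P. finite P \<and> P \<subseteq> W \<and> connected_set E P \<and> X \<subseteq> P"
proof (cases "X = {}")
  case True
  then show ?thesis by (intro exI[of _ "{}"]) (auto simp: connected_set_def)
next
  case False
  then obtain r where r: "r \<in> X" by auto
  have "\<forall>x\<in>X. \<exists>P. finite P \<and> P \<subseteq> W \<and> connected_set E P \<and> r \<in> P \<and> x \<in> P"
    using connected_in_finite_connected_set[OF assms(1) conn[OF r]] by blast
  then obtain P where P: "\<And>x. x \<in> X \<Longrightarrow>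
      finite (P x) \<and> P x \<subseteq> W \<and> connected_set E (P x) \<and> r \<in> P x \<and> x \<in> P x"
    by metis
  have "connected_set E (\<Union>x\<in>X. P x)"
    using P assms(1) by (intro connected_set_UN[of E X P r]) auto
  then show ?thesis using P assms(2)
    by (intro exI[of _ "\<Union>x\<in>X. P x"]) auto
qed

text \<open>
  The counterpart of cutting a path from \<open>a\<close> off at its first visit to \<open>s\<close>.
\<close>

lemma connected_set_trim:
  assumes "symp E" "connected_set E P" "a \<in> P" "s \<in> P"
  shows "\<exists>P' \<subseteq> P. connected_set E P' \<and> a \<in> P' \<and> s \<in> P' \<and>
           (\<forall>v\<in>P' - {s}. (a, v) \<in> connected_in (P - {s}) E)"
proof (cases "a = s")
  case True
  then show ?thesis using assms by (intro exI[of _ "{s}"]) (auto simp: connected_set_singleton)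
next
  case False
  let ?K = "{v. (a, v) \<in> connected_in (P - {s}) E}"
  have aK: "a \<in> ?K" using False assms by (auto intro: connected_in_refl)
  have "\<exists>k\<in>?K. E k s"
  proof (rule ccontr)
    assume no: "\<not> ?thesis"
    have "(a, s) \<in> connected_in P E" using assms by (auto intro: connected_setD)
    then have "s \<in> ?K"
    proof (rule connected_in_closed[OF _ aK])
      fix k u assume *: "k \<in> ?K" "k \<in> P" "u \<in> P" "E k u"
      then have "u \<noteq> s" using no by auto
      then have "(k, u) \<in> connected_in (P - {s}) E"
        using * by (intro connected_in_edge) (auto dest: connected_in_memD)
      then show "u \<in> ?K" using *(1) by (auto intro: connected_in_trans)
    qed
    then show False by (auto dest: connected_in_memD)
  qed
  then obtain k where "k \<in> ?K" "E k s" by blast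
  then have "connected_set E (?K \<union> {s})"
    using assms(1)
    by (intro connected_set_Un_edge[of E ?K "{s}" k s] connected_set_reachable connected_set_singleton) auto
  then show ?thesis using aK assms(4)
    by (intro exI[of _ "?K \<union> {s}"]) (auto dest: connected_in_memD)
qed

section \<open>Menger's theorem\<close>

text \<open>
  \<open>Z\<close> meets every path from \<open>A\<close> to \<open>B\<close> in the subgraph induced by \<open>W\<close>. It may contain vertices of
  \<open>A\<close> and \<open>B\<close>.
\<close>

definition separates :: "('a \<Rightarrow> 'a \<Rightarrow> bool) \<Rightarrow> 'a set \<Rightarrow> 'a set \<Rightarrow> 'a set \<Rightarrow> 'a set \<Rightarrow> bool" where
  "separates E W A B Z \<longleftrightarrow> (\<forall>a\<in>A. \<forall>b\<in>B. (a, b) \<notin> connected_in (W - Z) E)"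

lemma separates_sym: "symp E \<Longrightarrow> separates E W A B Z \<Longrightarrow> separates E W B A Z"
  by (auto simp: separates_def dest: connected_in_sym)

text \<open>
  As many disjoint sets meeting \<open>X\<close> as \<open>X\<close> has elements meet \<open>X\<close> in one element each, so that they can
  be indexed by \<open>X\<close>.
\<close>

lemma disjoint_transversal:
  assumes "finite X" "finite \<P>" "disjoint \<P>" "card \<P> = card X" "\<And>P. P \<in> \<P> \<Longrightarrow> P \<inter> X \<noteq> {}"
  shows "\<exists>p. (\<forall>x\<in>X. p x \<in> \<P> \<and> p x \<inter> X = {x}) \<and> disjoint_family_on p X"
proof -
  obtain c where c: "\<And>P. P \<in> \<P> \<Longrightarrow> c P \<in> P \<inter> X"
    using that[of "\<lambda>P. SOME x. x \<in> P \<inter> X"] assms(5) some_in_eq by blast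
  have inj: "inj_on c \<P>"
    using c assms(3) by (intro inj_onI) (metis Int_iff disjointD disjoint_iff)
  have im: "c ` \<P> = X"
    using c assms(1,4) card_image[OF inj] by (intro card_subset_eq) auto
  have unique: "P \<inter> X = {c P}" if P: "P \<in> \<P>" for P
  proof -
    have "x = c P" if "x \<in> P" "x \<in> X" for x
    proof -
      obtain Q where Q: "Q \<in> \<P>" "x = c Q" using \<open>x \<in> X\<close> unfolding im[symmetric] by blast
      then have "x \<in> P \<inter> Q" using c that by auto
      then have "P = Q" using assms(3) P Q by (metis disjointD empty_iff)
      then show ?thesis using Q by simp
    qed
    then show ?thesis using c[OF P] by auto
  qed
  let ?p = "the_inv_into \<P> c"
  have p: "?p x \<in> \<P>" "c (?p x) = x" if "x \<in> X" for x
    using that im inj the_inv_into_into[OF inj, of x \<P>] f_the_inv_into_f[OF inj, of x] by auto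
  have "disjoint_family_on ?p X"
    unfolding disjoint_family_on_def using p assms(3) by (metis disjointD)
  then show ?thesis using p unique by (intro exI[of _ ?p]) auto
qed

text \<open>The graph without the edge joining \<open>x\<close> and \<open>y\<close>.\<close>

definition delete_edge :: "'a \<Rightarrow> 'a \<Rightarrow> ('a \<Rightarrow> 'a \<Rightarrow> bool) \<Rightarrow> 'a \<Rightarrow> 'a \<Rightarrow> bool" where
  "delete_edge x y E = (\<lambda>u v. E u v \<and> {u, v} \<noteq> {x, y})"

lemma delete_edge_commute: "delete_edge x y E = delete_edge y x E"
  by (auto simp: delete_edge_def doubleton_eq_iff fun_eq_iff)

lemma symp_delete_edge: "symp E \<Longrightarrow> symp (delete_edge x y E)"
  by (auto simp: symp_def delete_edge_def insert_commute)

lemma delete_edge_le: "delete_edge x y E u v \<Longrightarrow> E u v"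
  by (auto simp: delete_edge_def)

text \<open>
  If \<open>T\<close> separates \<open>A\<close> from \<open>B\<close> once the edge \<open>x y\<close> is deleted, and \<open>y\<close> is on the side of \<open>B\<close>, then
  whatever separates \<open>A\<close> from \<open>insert x T\<close> without the edge separates \<open>A\<close> from \<open>B\<close> with it.
\<close>

lemma separates_via_deleted_edge:
  assumes T: "separates (delete_edge x y E) W A B T"
    and y: "\<And>a. a \<in> A \<Longrightarrow> (a, y) \<notin> connected_in (W - T) (delete_edge x y E)"
    and Z: "separates (delete_edge x y E) W A (insert x T) Z"
  shows "separates E W A B Z"
  unfolding separates_def
proof (intro ballI notI)
  fix a b assume a: "a \<in> A" and b: "b \<in> B" and ab: "(a, b) \<in> connected_in (W - Z) E"
  let ?E = "delete_edge x y E"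
  let ?K = "{v. (a, v) \<in> connected_in (W - Z - insert x T) ?E}"
  have K_sub: "(a, v) \<in> connected_in (W - T) ?E" "(a, v) \<in> connected_in (W - Z) ?E" if "v \<in> ?K" for v
    using that by (auto elim!: connected_in_mono)
  have hit: "v \<notin> insert x T" if "(a, v) \<in> connected_in (W - Z) ?E" for v
    using Z that a by (auto simp: separates_def)
  have "a \<in> W - Z" using ab by (rule connected_in_memD)
  then have "a \<in> ?K" using hit[of a] by (auto intro!: connected_in_refl)
  have "b \<in> ?K"
  proof (rule connected_in_closed[OF ab \<open>a \<in> ?K\<close>])
    fix k u assume k: "k \<in> ?K" and kW: "k \<in> W - Z" and u: "u \<in> W - Z" and E: "E k u"
    have "k \<noteq> y" using K_sub(1)[OF k] y[OF a] by auto
    moreover have "k \<noteq> x" using k by (auto dest: connected_in_memD)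
    ultimately have E': "?E k u" using E by (auto simp: delete_edge_def doubleton_eq_iff)
    have "(a, u) \<in> connected_in (W - Z) ?E"
      using K_sub(2)[OF k] connected_in_edge[of ?E, OF E' kW u] by (rule connected_in_trans)
    from hit[OF this] have "(k, u) \<in> connected_in (W - Z - insert x T) ?E"
      using k u by (intro connected_in_edge E') (auto dest: connected_in_memD)
    then show "u \<in> ?K" using k by (auto intro: connected_in_trans)
  qed
  then show False using K_sub(1)[of b] T a b by (auto simp: separates_def)
qed

text \<open>
  If only the deletion of an edge makes \<open>T\<close> a separator, then this edge can be oriented from the
  side of \<open>A\<close> to the side of \<open>B\<close>.
\<close>

lemma deleted_edge_orientation:
  assumes "symp E" "separates (delete_edge x0 y0 E) W A B T" "\<not> separates E W A B T"
  shows "\<exists>x y. {x, y} = {x0, y0} \<and>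
           (\<exists>a\<in>A. (a, x) \<in> connected_in (W - T) (delete_edge x0 y0 E)) \<and>
           (\<exists>b\<in>B. (b, y) \<in> connected_in (W - T) (delete_edge x0 y0 E))"
proof -
  let ?E = "delete_edge x0 y0 E"
  let ?R = "\<lambda>C. {v. \<exists>c\<in>C. (c, v) \<in> connected_in (W - T) ?E}"
  have symE: "symp ?E" by (rule symp_delete_edge[OF assms(1)])
  have dis: "v \<notin> ?R B" if v: "v \<in> ?R A" for v
  proof
    assume "v \<in> ?R B"
    with v obtain a b where ab: "a \<in> A" "b \<in> B" "(a, v) \<in> connected_in (W - T) ?E"
        "(b, v) \<in> connected_in (W - T) ?E" by auto
    have "(a, b) \<in> connected_in (W - T) ?E"
      by (rule connected_in_trans[OF ab(3) connected_in_sym[OF symE ab(4)]])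
    then show False using assms(2) ab(1,2) by (auto simp: separates_def)
  qed
  have step: "u \<in> ?R C" if k: "k \<in> ?R C" "k \<in> W - T" "u \<in> W - T" "E k u" "{k, u} \<noteq> {x0, y0}" for C k u
  proof -
    obtain c where c: "c \<in> C" "(c, k) \<in> connected_in (W - T) ?E" using k(1) by auto
    have "?E k u" using k by (simp add: delete_edge_def)
    from connected_in_trans[OF c(2) connected_in_edge[of ?E, OF this k(2,3)]] show ?thesis
      using c(1) by auto
  qed
  obtain a b where ab: "a \<in> A" "b \<in> B" "(a, b) \<in> connected_in (W - T) E"
    using assms(3) by (auto simp: separates_def)
  have aR: "a \<in> ?R A" and bR: "b \<in> ?R B"
    using ab(1,2) connected_in_refl[OF connected_in_memD(1)[OF ab(3)], of ?E]
      connected_in_refl[OF connected_in_memD(2)[OF ab(3)], of ?E] by auto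
  have "\<exists>k u. k \<in> ?R A \<and> u \<notin> ?R A \<and> {k, u} = {x0, y0}"
  proof (rule ccontr)
    assume no: "\<not> ?thesis"
    from ab(3) aR have "b \<in> ?R A"
    proof (rule connected_in_closed)
      fix k u assume k: "k \<in> ?R A" "k \<in> W - T" "u \<in> W - T" "E k u"
      show "u \<in> ?R A"
      proof (cases "{k, u} = {x0, y0}")
        case True
        then show ?thesis using no k(1) by blast
      next
        case False
        then show ?thesis by (rule step[OF k])
      qed
    qed
    then show False using dis bR by blast
  qed
  then obtain k u where ku: "k \<in> ?R A" "u \<notin> ?R A" "{k, u} = {x0, y0}" by blast
  have "u \<in> ?R B"
  proof (rule ccontr)
    assume uB: "u \<notin> ?R B"
    have "a \<in> - ?R B" using dis[OF aR] by blast
    with ab(3) have "b \<in> - ?R B"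
    proof (rule connected_in_closed)
      fix v w assume v: "v \<in> - ?R B" "v \<in> W - T" "w \<in> W - T" "E v w"
      show "w \<in> - ?R B"
      proof (rule ccontr)
        assume "w \<notin> - ?R B"
        then have w: "w \<in> ?R B" by blast
        then have "w \<noteq> k" "w \<noteq> u" using dis[OF ku(1)] uB by metis+
        then have "{w, v} \<noteq> {x0, y0}" unfolding ku(3)[symmetric] by (simp add: doubleton_eq_iff)
        moreover have "E w v" using v(4) assms(1) by (auto simp: symp_def)
        ultimately have "v \<in> ?R B" by (intro step[OF w v(3,2)])
        then show False using v(1) by blast
      qed
    qed
    then show False using bR by blast
  qed
  then show ?thesis using ku by blast
qed

text \<open>
  Disjoint paths from \<open>A\<close> to all vertices of \<open>X\<close> can be chosen to meet \<open>X\<close> only in their last vertices.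
\<close>

lemma trimmed_linkage:
  assumes "symp E" "finite X" "finite \<P>" "disjoint \<P>" "card \<P> = card X"
    and \<P>: "\<And>P. P \<in> \<P> \<Longrightarrow> P \<subseteq> W \<and> connected_set E P \<and> P \<inter> A \<noteq> {} \<and> P \<inter> X \<noteq> {}"
  shows "\<exists>p. disjoint_family_on p X \<and> (\<forall>x\<in>X. x \<in> p x \<and> p x \<subseteq> W \<and> connected_set E (p x) \<and> p x \<inter> A \<noteq> {} \<and>
           (\<forall>v\<in>p x - {x}. \<exists>a\<in>A. (a, v) \<in> connected_in (W - X) E))"
proof -
  have "\<exists>q. (\<forall>x\<in>X. q x \<in> \<P> \<and> q x \<inter> X = {x}) \<and> disjoint_family_on q X"
    using \<P> by (intro disjoint_transversal[OF assms(2-5)]) blast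
  then obtain q where q: "\<And>x. x \<in> X \<Longrightarrow> q x \<in> \<P> \<and> q x \<inter> X = {x}" and dis: "disjoint_family_on q X"
    by (elim exE conjE) blast
  have "\<exists>P\<subseteq>q x. connected_set E P \<and> x \<in> P \<and> P \<inter> A \<noteq> {} \<and>
          (\<forall>v\<in>P - {x}. \<exists>a\<in>A. (a, v) \<in> connected_in (W - X) E)" if x: "x \<in> X" for x
  proof -
    have qx: "q x \<subseteq> W" "connected_set E (q x)" "x \<in> q x" using \<P> q[OF x] by auto
    obtain a where a: "a \<in> q x" "a \<in> A" using \<P> q[OF x] by blast
    obtain P where P: "P \<subseteq> q x" "connected_set E P" "a \<in> P" "x \<in> P"
        "\<forall>v\<in>P - {x}. (a, v) \<in> connected_in (q x - {x}) E"
      using connected_set_trim[OF assms(1) qx(2) a(1) qx(3)] by blast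
    have "q x - {x} \<subseteq> W - X" using q[OF x] qx by auto
    then have "\<forall>v\<in>P - {x}. (a, v) \<in> connected_in (W - X) E"
      using P(5) by (blast intro: connected_in_mono[of a _ "q x - {x}" E])
    then show ?thesis using P a by (intro exI[of _ P]) auto
  qed
  then obtain p where p: "\<And>x. x \<in> X \<Longrightarrow> p x \<subseteq> q x \<and> connected_set E (p x) \<and> x \<in> p x \<and> p x \<inter> A \<noteq> {} \<and>
          (\<forall>v\<in>p x - {x}. \<exists>a\<in>A. (a, v) \<in> connected_in (W - X) E)"
    by metis
  have "disjoint_family_on p X"
    unfolding disjoint_family_on_def
  proof (intro ballI impI)
    fix x y assume "x \<in> X" "y \<in> X" "x \<noteq> y"
    then show "p x \<inter> p y = {}"
      using disjoint_family_onD[OF dis] p[of x] p[of y] by blast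
  qed
  moreover have "p x \<subseteq> W" if "x \<in> X" for x
    using p[OF that] q[OF that] \<P> by blast
  ultimately show ?thesis using p by (intro exI[of _ p]) blast
qed

text \<open>
  Goering's proof of Menger's theorem, by induction on the number of edges. If deleting the edge \<open>x y\<close>
  creates a separator \<open>T\<close> with fewer than \<open>n\<close> vertices, then \<open>insert x T\<close> and \<open>insert y T\<close> have \<open>n\<close>
  elements each, and paths from \<open>A\<close> to the former and from the latter to \<open>B\<close> fit together.
\<close>

lemma menger_finite:
  assumes "finite W" "symp E" "\<And>u. \<not> E u u"
    and "\<And>Z. finite Z \<Longrightarrow> separates E W A B Z \<Longrightarrow> n \<le> card Z"
  shows "\<exists>\<P>. finite \<P> \<and> card \<P> = n \<and> disjoint \<P> \<and>
           (\<forall>P\<in>\<P>. P \<subseteq> W \<and> connected_set E P \<and> P \<inter> A \<noteq> {} \<and> P \<inter> B \<noteq> {})"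
  using assms(2-)
proof (induction "card {(u, v) \<in> W \<times> W. E u v}" arbitrary: E A B rule: less_induct)
  case less
  note sym = less.prems(1) and irr = less.prems(2) and sep = less.prems(3)
  show ?case
  proof (cases "\<exists>x\<in>W. \<exists>y\<in>W. E x y")
    case False
    have "separates E W A B (A \<inter> B \<inter> W)"
      unfolding separates_def
    proof (intro ballI notI)
      fix a b assume ab: "a \<in> A" "b \<in> B" "(a, b) \<in> connected_in (W - A \<inter> B \<inter> W) E"
      have "b \<in> {a}"
        using ab(3) by (rule connected_in_closed) (use False in auto)
      then show False using ab by (auto dest: connected_in_memD)
    qed
    then have "n \<le> card (A \<inter> B \<inter> W)" using assms(1) sep by auto
    then obtain X where X: "X \<subseteq> A \<inter> B \<inter> W" "card X = n" "finite X"
      using obtain_subset_with_card_n by metis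
    show ?thesis
    proof (intro exI[of _ "(\<lambda>x. {x}) ` X"] conjI ballI)
      show "card ((\<lambda>x. {x}) ` X) = n" using X by (simp add: card_image)
      show "disjoint ((\<lambda>x. {x}) ` X)" by (auto simp: disjoint_def)
    qed (use X in \<open>auto simp: connected_set_singleton\<close>)
  next
    case True
    then obtain x0 y0 where e: "x0 \<in> W" "y0 \<in> W" "E x0 y0" by auto
    have smaller: "card {(u, v) \<in> W \<times> W. delete_edge x0 y0 E u v} < card {(u, v) \<in> W \<times> W. E u v}"
    proof (rule psubset_card_mono)
      show "finite {(u, v) \<in> W \<times> W. E u v}"
        using assms(1) by (auto intro: finite_subset[of _ "W \<times> W"])
      have "(x0, y0) \<in> {(u, v) \<in> W \<times> W. E u v} - {(u, v) \<in> W \<times> W. delete_edge x0 y0 E u v}"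
        using e by (auto simp: delete_edge_def)
      then show "{(u, v) \<in> W \<times> W. delete_edge x0 y0 E u v} \<subset> {(u, v) \<in> W \<times> W. E u v}"
        by (auto simp: delete_edge_def)
    qed
    have irr': "\<not> delete_edge x0 y0 E u u" for u
      using irr by (auto simp: delete_edge_def)
    have IH: "\<exists>\<P>. finite \<P> \<and> card \<P> = n \<and> disjoint \<P> \<and>
           (\<forall>P\<in>\<P>. P \<subseteq> W \<and> connected_set (delete_edge x0 y0 E) P \<and> P \<inter> A' \<noteq> {} \<and> P \<inter> B' \<noteq> {})"
      if "\<And>Z. finite Z \<Longrightarrow> separates (delete_edge x0 y0 E) W A' B' Z \<Longrightarrow> n \<le> card Z" for A' B'
      by (rule less.hyps[OF smaller symp_delete_edge[OF sym] irr' that])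
    show ?thesis
    proof (cases "\<forall>Z. finite Z \<longrightarrow> separates (delete_edge x0 y0 E) W A B Z \<longrightarrow> n \<le> card Z")
      case True
      then obtain \<P> where "finite \<P>" "card \<P> = n" "disjoint \<P>"
         "\<forall>P\<in>\<P>. P \<subseteq> W \<and> connected_set (delete_edge x0 y0 E) P \<and> P \<inter> A \<noteq> {} \<and> P \<inter> B \<noteq> {}"
        using IH[of A B] by blast
      moreover have "connected_set E P" if "connected_set (delete_edge x0 y0 E) P" for P
        using that by (rule connected_set_mono) (rule delete_edge_le)
      ultimately show ?thesis by blast
    next
      case False
      then obtain T where T: "finite T" "separates (delete_edge x0 y0 E) W A B T" "card T < n"
        by (metis linorder_not_le)
      let ?E = "delete_edge x0 y0 E"
      have symE: "symp ?E" by (rule symp_delete_edge[OF sym])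
      let ?RA = "{v. \<exists>a\<in>A. (a, v) \<in> connected_in (W - T) ?E}"
      let ?RB = "{v. \<exists>b\<in>B. (b, v) \<in> connected_in (W - T) ?E}"
      have RARB: "?RA \<inter> ?RB = {}"
      proof (rule ccontr)
        assume "?RA \<inter> ?RB \<noteq> {}"
        then obtain a b v where "a \<in> A" "b \<in> B" "(a, v) \<in> connected_in (W - T) ?E"
            "(b, v) \<in> connected_in (W - T) ?E" by auto
        then show False using T(2) unfolding separates_def
          by (meson connected_in_sym[OF symE] connected_in_trans)
      qed
      have "\<exists>x y. {x, y} = {x0, y0} \<and> x \<in> ?RA \<and> y \<in> ?RB"
        using deleted_edge_orientation[OF sym T(2)] sep[of T] T by auto
      then obtain x y where xy: "{x, y} = {x0, y0}" "x \<in> ?RA" "y \<in> ?RB" by blast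
      have E_xy: "?E = delete_edge x y E" "?E = delete_edge y x E"
        using xy(1) by (auto simp: doubleton_eq_iff delete_edge_commute)
      have Exy: "E x y" using e(3) xy(1) sym by (auto simp: doubleton_eq_iff symp_def)
      have xT: "x \<notin> T" and yT: "y \<notin> T" using xy by (auto dest: connected_in_memD)
      have Bsep: "separates ?E W B A T" by (rule separates_sym[OF symE T(2)])
      have yA: "(a, y) \<notin> connected_in (W - T) ?E" if "a \<in> A" for a
        using that RARB xy by auto
      have xB: "(b, x) \<notin> connected_in (W - T) ?E" if "b \<in> B" for b
        using that RARB xy by auto
      have sepA: "n \<le> card Z" if "finite Z" "separates ?E W A (insert x T) Z" for Z
        using sep[OF that(1) separates_via_deleted_edge[of x y E W A B T Z]] T(2) yA that
        by (simp add: E_xy(1))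
      have sepB: "n \<le> card Z" if "finite Z" "separates ?E W B (insert y T) Z" for Z
        using sep[OF that(1) separates_sym[OF sym separates_via_deleted_edge[of y x E W B A T Z]]]
          Bsep xB that
        by (simp add: E_xy(2))
      have "n \<le> card (insert x T)"
        using T(1) by (intro sepA) (auto simp: separates_def dest: connected_in_memD)
      then have cT: "Suc (card T) = n" using T xT by simp
      have "\<exists>\<P>. finite \<P> \<and> card \<P> = n \<and> disjoint \<P> \<and>
         (\<forall>P\<in>\<P>. P \<subseteq> W \<and> connected_set ?E P \<and> P \<inter> A \<noteq> {} \<and> P \<inter> (insert x T) \<noteq> {})"
        by (rule IH) (rule sepA)
      then obtain \<P> where \<P>: "finite \<P>" "card \<P> = n" "disjoint \<P>"
         "\<forall>P\<in>\<P>. P \<subseteq> W \<and> connected_set ?E P \<and> P \<inter> A \<noteq> {} \<and> P \<inter> (insert x T) \<noteq> {}"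
        by (elim exE conjE)
      have "\<exists>\<Q>. finite \<Q> \<and> card \<Q> = n \<and> disjoint \<Q> \<and>
         (\<forall>P\<in>\<Q>. P \<subseteq> W \<and> connected_set ?E P \<and> P \<inter> B \<noteq> {} \<and> P \<inter> (insert y T) \<noteq> {})"
        by (rule IH) (rule sepB)
      then obtain \<Q> where \<Q>: "finite \<Q>" "card \<Q> = n" "disjoint \<Q>"
         "\<forall>P\<in>\<Q>. P \<subseteq> W \<and> connected_set ?E P \<and> P \<inter> B \<noteq> {} \<and> P \<inter> (insert y T) \<noteq> {}"
        by (elim exE conjE)
      have "\<exists>p. disjoint_family_on p (insert x T) \<and> (\<forall>z\<in>insert x T. z \<in> p z \<and> p z \<subseteq> W \<and>
           connected_set ?E (p z) \<and> p z \<inter> A \<noteq> {} \<and>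
           (\<forall>v\<in>p z - {z}. \<exists>a\<in>A. (a, v) \<in> connected_in (W - insert x T) ?E))"
        using T(1) xT cT \<P>(2) bspec[OF \<P>(4)]
        by (intro trimmed_linkage[OF symE _ \<P>(1,3)]) simp_all
      then obtain p where p: "disjoint_family_on p (insert x T)"
        "\<And>z. z \<in> insert x T \<Longrightarrow> z \<in> p z \<and> p z \<subseteq> W \<and> connected_set ?E (p z) \<and> p z \<inter> A \<noteq> {} \<and>
           (\<forall>v\<in>p z - {z}. \<exists>a\<in>A. (a, v) \<in> connected_in (W - insert x T) ?E)"
        by (elim exE conjE) blast
      have "\<exists>p. disjoint_family_on p (insert y T) \<and> (\<forall>z\<in>insert y T. z \<in> p z \<and> p z \<subseteq> W \<and>
           connected_set ?E (p z) \<and> p z \<inter> B \<noteq> {} \<and>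
           (\<forall>v\<in>p z - {z}. \<exists>a\<in>B. (a, v) \<in> connected_in (W - insert y T) ?E))"
        using T(1) yT cT \<Q>(2) bspec[OF \<Q>(4)]
        by (intro trimmed_linkage[OF symE _ \<Q>(1,3)]) simp_all
      then obtain q where q: "disjoint_family_on q (insert y T)"
        "\<And>z. z \<in> insert y T \<Longrightarrow> z \<in> q z \<and> q z \<subseteq> W \<and> connected_set ?E (q z) \<and> q z \<inter> B \<noteq> {} \<and>
           (\<forall>v\<in>q z - {z}. \<exists>a\<in>B. (a, v) \<in> connected_in (W - insert y T) ?E)"
        by (elim exE conjE) blast
      \<comment> \<open>The paths ending in \<open>insert x T\<close> and those starting in \<open>insert y T\<close> live on different sides of
          \<open>T\<close>.\<close>
      have pRA: "p z \<subseteq> ?RA \<union> ({z} \<inter> T)" if z: "z \<in> insert x T" for z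
      proof
        fix v assume "v \<in> p z"
        show "v \<in> ?RA \<union> ({z} \<inter> T)"
        proof (cases "v = z")
          case True
          then show ?thesis using z xy by auto
        next
          case False
          then obtain a where "a \<in> A" "(a, v) \<in> connected_in (W - insert x T) ?E"
            using p(2)[OF z] \<open>v \<in> p z\<close> by blast
          then have "(a, v) \<in> connected_in (W - T) ?E" by (auto elim: connected_in_mono)
          then show ?thesis using \<open>a \<in> A\<close> by auto
        qed
      qed
      have qRB: "q z \<subseteq> ?RB \<union> ({z} \<inter> T)" if z: "z \<in> insert y T" for z
      proof
        fix v assume "v \<in> q z"
        show "v \<in> ?RB \<union> ({z} \<inter> T)"
        proof (cases "v = z")
          case True
          then show ?thesis using z xy by auto
        next
          case False
          then obtain a where "a \<in> B" "(a, v) \<in> connected_in (W - insert y T) ?E"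
            using q(2)[OF z] \<open>v \<in> q z\<close> by blast
          then have "(a, v) \<in> connected_in (W - T) ?E" by (auto elim: connected_in_mono)
          then show ?thesis using \<open>a \<in> B\<close> by auto
        qed
      qed
      have RT: "(?RA \<union> ?RB) \<inter> T = {}" by (auto dest: connected_in_memD)
      define m where "m z = (if z = x then y else z)" for z
      have m: "m z \<in> insert y T" if "z \<in> insert x T" for z
        using that by (auto simp: m_def)
      have m_inj: "m z \<noteq> m z'" if "z \<in> insert x T" "z' \<in> insert x T" "z \<noteq> z'" for z z'
        using that yT by (auto simp: m_def)
      have m_T: "m z = z" if "z \<in> T" for z using that xT by (auto simp: m_def)
      have pq: "p z \<inter> q (m z') = {}" if z: "z \<in> insert x T" "z' \<in> insert x T" "z \<noteq> z'" for z z'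
      proof (rule equals0I)
        fix v assume "v \<in> p z \<inter> q (m z')"
        then have v: "v \<in> ?RA \<union> ({z} \<inter> T)" "v \<in> ?RB \<union> ({m z'} \<inter> T)"
          using subsetD[OF pRA[OF z(1)]] subsetD[OF qRB[OF m[OF z(2)]]] by (blast, blast)
        have "v \<notin> ?RA \<or> v \<notin> ?RB" using RARB by blast
        moreover have "v \<in> T \<Longrightarrow> v \<notin> ?RA \<and> v \<notin> ?RB" using RT by blast
        ultimately have "v = z" "v = m z'" "v \<in> T" using v by blast+
        then show False using m_inj[OF z] m_T[of z] by metis
      qed
      let ?r = "\<lambda>z. p z \<union> q (m z)"
      have r_dis: "?r z \<inter> ?r z' = {}" if z: "z \<in> insert x T" "z' \<in> insert x T" "z \<noteq> z'" for z z'
      proof -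
        have "p z \<inter> p z' = {}" by (rule disjoint_family_onD[OF p(1) z])
        moreover have "q (m z) \<inter> q (m z') = {}"
          by (rule disjoint_family_onD[OF q(1) m[OF z(1)] m[OF z(2)] m_inj[OF z]])
        ultimately show ?thesis using pq[OF z] pq[OF z(2,1) not_sym[OF z(3)]] by blast
      qed
      have r_conn: "connected_set E (?r z)" if z: "z \<in> insert x T" for z
      proof (rule connected_set_Un_edge[OF sym])
        show "connected_set E (p z)" "connected_set E (q (m z))"
          using p(2)[OF z] q(2)[OF m[OF z]] by (auto intro: connected_set_mono[OF _ delete_edge_le])
        show "z \<in> p z" "m z \<in> q (m z)" using p(2)[OF z] q(2)[OF m[OF z]] by auto
        show "z = m z \<or> E z (m z)" using Exy by (auto simp: m_def)
      qed
      have r_inj: "inj_on ?r (insert x T)"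
      proof (rule inj_onI, rule ccontr)
        fix z z' assume z: "z \<in> insert x T" "z' \<in> insert x T" "?r z = ?r z'" "z \<noteq> z'"
        then show False using r_dis[OF z(1,2,4)] p(2)[OF z(1)] by blast
      qed
      show ?thesis
      proof (intro exI[of _ "?r ` insert x T"] conjI ballI)
        show "finite (?r ` insert x T)" using T(1) by blast
        show "card (?r ` insert x T) = n" using card_image[OF r_inj] T(1) xT cT by simp
        show "disjoint (?r ` insert x T)"
          unfolding disjoint_def using r_dis by blast
        fix P assume "P \<in> ?r ` insert x T"
        then obtain z where z: "z \<in> insert x T" "P = ?r z" by blast
        show "P \<subseteq> W" "P \<inter> A \<noteq> {}" "P \<inter> B \<noteq> {}" using z p(2)[OF z(1)] q(2)[OF m[OF z(1)]] by blast+
        show "connected_set E P" using r_conn z by blast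
      qed
    qed
  qed
qed

text \<open>
  Reduction of Menger's theorem to finite graphs: take a path \<open>P\<close> from \<open>A\<close> to \<open>B\<close> avoiding \<open>Z0\<close>, and
  recursively a finite subgraph for each \<open>insert x Z0\<close> with \<open>x \<in> P\<close>. A separator that contains
  \<open>Z0\<close> must contain some \<open>x \<in> P\<close>.
\<close>

lemma finite_subgraph_without_small_separator:
  assumes "symp E" "finite Z0"
    and "\<And>Z. finite Z \<Longrightarrow> separates E W A B Z \<Longrightarrow> n \<le> card Z"
  shows "\<exists>W0. finite W0 \<and> W0 \<subseteq> W \<and>
           (\<forall>Z. finite Z \<longrightarrow> Z0 \<subseteq> Z \<longrightarrow> separates E W0 A B Z \<longrightarrow> n \<le> card Z)"
  using assms(2)
proof (induction "n - card Z0" arbitrary: Z0 rule: less_induct)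
  case less
  show ?case
  proof (cases "n \<le> card Z0")
    case True
    then show ?thesis by (intro exI[of _ "{}"]) (auto dest: card_mono)
  next
    case False
    then obtain a b where ab: "a \<in> A" "b \<in> B" "(a, b) \<in> connected_in (W - Z0) E"
      using assms(3)[OF less.prems] by (auto simp: separates_def)
    obtain P where P: "finite P" "P \<subseteq> W - Z0" "connected_set E P" "a \<in> P" "b \<in> P"
      using connected_in_finite_connected_set[OF assms(1) ab(3)] by auto
    have "\<exists>W0. finite W0 \<and> W0 \<subseteq> W \<and>
        (\<forall>Z. finite Z \<longrightarrow> insert x Z0 \<subseteq> Z \<longrightarrow> separates E W0 A B Z \<longrightarrow> n \<le> card Z)" if "x \<in> P" for x
    proof (rule less.hyps)
      have "x \<notin> Z0" using that P by auto
      then show "n - card (insert x Z0) < n - card Z0" using less.prems False by simp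
    qed (use less.prems in simp)
    then obtain U where U: "\<And>x. x \<in> P \<Longrightarrow> finite (U x) \<and> U x \<subseteq> W \<and>
        (\<forall>Z. finite Z \<longrightarrow> insert x Z0 \<subseteq> Z \<longrightarrow> separates E (U x) A B Z \<longrightarrow> n \<le> card Z)"
      by metis
    let ?W = "P \<union> (\<Union>x\<in>P. U x)"
    show ?thesis
    proof (intro exI[of _ ?W] conjI allI impI)
      show "finite ?W" "?W \<subseteq> W" using P U by auto
      fix Z assume Z: "finite Z" "Z0 \<subseteq> Z" "separates E ?W A B Z"
      have "P \<inter> Z \<noteq> {}"
      proof
        assume "P \<inter> Z = {}"
        then have "(a, b) \<in> connected_in (?W - Z) E"
          using P by (intro connected_set_subset_in[of E P]) auto
        then show False using Z(3) ab by (auto simp: separates_def)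
      qed
      then obtain x where x: "x \<in> P" "x \<in> Z" by auto
      have "separates E (U x) A B Z"
        unfolding separates_def
      proof (intro ballI notI)
        fix a b assume "a \<in> A" "b \<in> B" and *: "(a, b) \<in> connected_in (U x - Z) E"
        from * have "(a, b) \<in> connected_in (?W - Z) E"
          using x by (elim connected_in_mono) auto
        then show False using Z(3) \<open>a \<in> A\<close> \<open>b \<in> B\<close> by (auto simp: separates_def)
      qed
      then show "n \<le> card Z" using U[OF x(1)] Z x by auto
    qed
  qed
qed

text \<open>
  Menger's theorem for a finite set \<open>A\<close> in an arbitrary graph, in the case that all of \<open>A\<close> can be linked
  to \<open>B\<close>.
\<close>

lemma menger_linkage:
  assumes "symp E" "\<And>u. \<not> E u u" "finite A"
    and "\<And>Z. finite Z \<Longrightarrow> separates E W A B Z \<Longrightarrow> card A \<le> card Z"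
  shows "\<exists>p. disjoint_family_on p A \<and>
           (\<forall>a\<in>A. a \<in> p a \<and> finite (p a) \<and> p a \<subseteq> W \<and> connected_set E (p a) \<and> p a \<inter> B \<noteq> {})"
proof -
  obtain W0 where W0: "finite W0" "W0 \<subseteq> W"
      "\<And>Z. finite Z \<Longrightarrow> separates E W0 A B Z \<Longrightarrow> card A \<le> card Z"
    using finite_subgraph_without_small_separator[OF assms(1) finite.emptyI, of W A B "card A"] assms(4)
    by auto
  obtain \<P> where \<P>: "finite \<P>" "card \<P> = card A" "disjoint \<P>"
      "\<forall>P\<in>\<P>. P \<subseteq> W0 \<and> connected_set E P \<and> P \<inter> A \<noteq> {} \<and> P \<inter> B \<noteq> {}"
    using menger_finite[OF W0(1) assms(1,2), of A B "card A"] W0(3) by metis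
  obtain p where p: "\<And>x. x \<in> A \<Longrightarrow> p x \<in> \<P> \<and> p x \<inter> A = {x}" "disjoint_family_on p A"
    using disjoint_transversal[OF assms(3) \<P>(1,3,2)] \<P>(4) by metis
  have "a \<in> p a \<and> finite (p a) \<and> p a \<subseteq> W \<and> connected_set E (p a) \<and> p a \<inter> B \<noteq> {}" if "a \<in> A" for a
    using p(1)[OF that] bspec[OF \<P>(4), of "p a"] W0 finite_subset[OF _ W0(1), of "p a"] by auto
  then show ?thesis using p(2) by (intro exI[of _ p]) auto
qed

section \<open>Rays along chains of connected sets\<close>

lemma rayI:
  "range R \<subseteq> V \<Longrightarrow> inj R \<Longrightarrow> (\<And>n. E (R n) (R (Suc n))) \<Longrightarrow> R \<in> rays V E"
  by (auto simp: rays_def)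

text \<open>
  The union of the chain need not be locally finite, so that being infinite and connected would not
  provide a ray. What does is that every finite set is avoided by a connected tail of the chain.
\<close>

lemma ray_from_unbounded_chain:
  assumes "symp E"
    and in_V: "\<And>m. W m \<subseteq> V"
    and conn: "\<And>m. connected_set E (W m)"
    and meet: "\<And>m. W m \<inter> W (Suc m) \<noteq> {}"
    and fin: "\<And>v. finite {m. v \<in> W m}"
  shows "\<exists>R \<in> rays V E. range R \<subseteq> (\<Union>m. W m)"
proof -
  define G where "G M = (\<Union>m\<in>{M..}. W m)" for M
  have G_conn: "connected_set E (G M)" for M
  proof -
    obtain r where r: "r \<in> W M" using meet[of M] by auto
    have "\<forall>x\<in>W m. (r, x) \<in> connected_in (G M) E" if "M \<le> m" for m
      using that
    proof (induction m rule: dec_induct)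
      case base
      then show ?case using r conn
        by (auto intro!: connected_set_subset_in[of E "W M"] simp: G_def)
    next
      case (step m)
      obtain z where z: "z \<in> W m" "z \<in> W (Suc m)" using meet[of m] by auto
      have "W (Suc m) \<subseteq> G M" using step.hyps by (fastforce simp: G_def)
      then have "(z, x) \<in> connected_in (G M) E" if "x \<in> W (Suc m)" for x
        using z that conn by (intro connected_set_subset_in[of E "W (Suc m)"])
      then show ?case using step.IH z(1) by (blast intro: connected_in_trans)
    qed
    then show ?thesis
      by (intro connected_setI_root[OF assms(1), of _ r]) (auto simp: G_def)
  qed
  have G_avoid: "\<exists>M'\<ge>M. G M' \<inter> F = {}" if "finite F" for F M
  proof -
    have "finite (\<Union>v\<in>F. {m. v \<in> W m})" using that fin by auto
    then obtain N where "\<And>m. m \<in> (\<Union>v\<in>F. {m. v \<in> W m}) \<Longrightarrow> m < N"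
      by (auto simp: finite_nat_set_iff_bounded)
    then show ?thesis
      by (intro exI[of _ "max M N"]) (fastforce simp: G_def)
  qed
  have G_anti: "G M' \<subseteq> G M" if "M \<le> M'" for M M'
    using that unfolding G_def by (intro UN_mono) auto
  have G_ne: "G M \<noteq> {}" for M
    using meet[of M] by (auto simp: G_def)
  \<comment> \<open>A finite path can be prolonged for ever if its last vertex \<open>v\<close> is joined, in what the earlier
     vertices \<open>F\<close> leave, to a part of the chain that avoids \<open>F\<close>.\<close>
  define P where "P = (\<lambda>(F, v). finite F \<and> v \<notin> F \<and>
      (\<exists>M. G M \<inter> F = {} \<and> (\<exists>g\<in>G M. (v, g) \<in> connected_in (G 0 - F) E)))"
  have "\<exists>s. \<forall>n. P (s n) \<and> fst (s (Suc n)) = insert (snd (s n)) (fst (s n)) \<and>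
          E (snd (s n)) (snd (s (Suc n)))"
  proof -
    obtain v where "v \<in> G 0" using G_ne[of 0] by auto
    then have "P ({}, v)" by (auto simp: P_def intro!: exI[of _ 0] connected_in_refl)
    moreover have "\<exists>t. P t \<and> fst t = insert (snd s) (fst s) \<and> E (snd s) (snd t)" if "P s" for s
    proof -
      obtain F v where s: "s = (F, v)" by (cases s)
      obtain M g where *: "finite F" "v \<notin> F" "G M \<inter> F = {}" "g \<in> G M"
          "(v, g) \<in> connected_in (G 0 - F) E"
        using \<open>P s\<close> by (auto simp: P_def s)
      obtain M' where M': "M \<le> M'" "G M' \<inter> insert v F = {}"
        using G_avoid[of "insert v F" M] *(1) by auto
      obtain g' where g': "g' \<in> G M'" using G_ne by blast
      have "(g, g') \<in> connected_in (G 0 - F) E"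
        using * g' G_anti[OF M'(1)] G_anti[of 0 M] G_conn[of M]
        by (intro connected_set_subset_in[of E "G M"]) auto
      with *(5) have "(v, g') \<in> connected_in (G 0 - F) E" by (rule connected_in_trans)
      then obtain u where u: "E v u" "(u, g') \<in> connected_in (G 0 - F - {v}) E"
        using connected_in_last_exit[of v g'] g' M'(2) by blast
      have "P (insert v F, u)"
        using * M' g' u connected_in_memD(1)[OF u(2)]
        by (auto simp: P_def Diff_insert2[symmetric] simp flip: Diff_insert)
      then show ?thesis using u(1) by (intro exI[of _ "(insert v F, u)"]) (auto simp: s)
    qed
    ultimately show ?thesis
      using dependent_nat_choice[of "\<lambda>_. P" "\<lambda>_ s t. fst t = insert (snd s) (fst s) \<and> E (snd s) (snd t)"]
      by blast
  qed
  then obtain s where s: "\<And>n. P (s n)" "\<And>n. fst (s (Suc n)) = insert (snd (s n)) (fst (s n))"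
      "\<And>n. E (snd (s n)) (snd (s (Suc n)))" by blast
  let ?R = "\<lambda>n. snd (s n)"
  have past: "?R i \<in> fst (s j)" if "i < j" for i j
    using that by (induction j) (auto simp: s(2) less_Suc_eq)
  have new: "?R j \<notin> fst (s j)" for j
    using s(1)[of j] by (auto simp: P_def split: prod.splits)
  have "inj ?R"
    using past new by (intro linorder_injI) metis
  moreover have sub: "?R j \<in> (\<Union>m. W m)" for j
    using s(1)[of j] by (auto simp: P_def G_def split: prod.splits dest!: connected_in_memD(1))
  ultimately show ?thesis using s(3) in_V
    by (intro bexI[of _ ?R] rayI) blast+
qed

text \<open>
  One step of the construction of many disjoint rays: every vertex \<open>s \<in> S\<close> is joined to \<open>S'\<close> by a
  connected set \<open>p s\<close>, these sets being pairwise disjoint and avoiding what has been used before.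
\<close>

definition linked :: "'a set \<Rightarrow> ('a \<Rightarrow> 'a \<Rightarrow> bool) \<Rightarrow> 'a set \<Rightarrow> 'a set \<Rightarrow> 'a set \<Rightarrow> ('a \<Rightarrow> 'a set) \<Rightarrow> bool" where
  "linked V E F S S' p \<longleftrightarrow>
     (\<forall>s\<in>S. s \<in> p s \<and> connected_set E (p s) \<and> p s \<subseteq> V - F \<and> p s \<inter> S' \<noteq> {}) \<and>
     disjoint_family_on p S \<and> S' \<inter> (F \<union> S) = {}"

text \<open>
  If linking can be continued for ever, the chains of linking sets carry disjoint rays. The
  invariant \<open>I\<close> speaks of the vertices \<open>F\<close> used up so far and of the current ends \<open>S\<close> of the strands.
\<close>

lemma disjoint_rays_from_linkages:
  assumes "symp E"
    and step: "\<And>F S. I F S \<Longrightarrow> \<exists>p S'. linked V E F S S' p \<and> I ((F \<union> (\<Union>s\<in>S. p s)) - S') S'"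
    and init: "I {} S0"
  shows "\<exists>r. (\<forall>s\<in>S0. r s \<in> rays V E) \<and> disjoint_family_on (\<lambda>s. range (r s)) S0"
proof -
  let ?next = "\<lambda>(F, S) (F', S'). \<exists>p. linked V E F S S' p \<and> F' = (F \<union> (\<Union>s\<in>S. p s)) - S'"
  have "\<exists>t. \<forall>n. (case_prod I (t n) \<and> (n = 0 \<longrightarrow> t n = ({}, S0))) \<and> ?next (t n) (t (Suc n))"
  proof (rule dependent_nat_choice[where P = "\<lambda>n t. case_prod I t \<and> (n = 0 \<longrightarrow> t = ({}, S0))" and
        Q = "\<lambda>n. ?next"])
    show "\<exists>t. case_prod I t \<and> (0 = 0 \<longrightarrow> t = ({}, S0))"
      using init by auto
    fix t and n :: nat assume t: "case_prod I t \<and> (n = 0 \<longrightarrow> t = ({}, S0))"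
    obtain F S where FS: "t = (F, S)" by (cases t)
    with t have "I F S" by simp
    from step[OF this] obtain p S' where "linked V E F S S' p" "I ((F \<union> (\<Union>s\<in>S. p s)) - S') S'"
      by (elim exE conjE)
    then show "\<exists>u. (case_prod I u \<and> (Suc n = 0 \<longrightarrow> u = ({}, S0))) \<and> ?next t u"
      by (intro exI[of _ "((F \<union> (\<Union>s\<in>S. p s)) - S', S')"]) (auto simp: FS)
  qed
  then obtain t where t': "\<forall>n. (case_prod I (t n) \<and> (n = 0 \<longrightarrow> t n = ({}, S0))) \<and> ?next (t n) (t (Suc n))"
    by (elim exE)
  have t: "?next (t n) (t (Suc n))" and t_0: "t 0 = ({}, S0)" for n
    using conjunct2[OF spec[OF t', of n]] conjunct1[OF spec[OF t', of 0]] by simp_all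
  define F S where "F n = fst (t n)" and "S n = snd (t n)" for n
  have "\<exists>p. linked V E (F n) (S n) (S (Suc n)) p \<and> F (Suc n) = (F n \<union> (\<Union>s\<in>S n. p s)) - S (Suc n)" for n
    using t[of n] by (auto simp: F_def S_def split_def)
  then obtain p where p: "\<And>n. linked V E (F n) (S n) (S (Suc n)) (p n)"
      "\<And>n. F (Suc n) = (F n \<union> (\<Union>s\<in>S n. p n s)) - S (Suc n)" by metis
  have S0: "S 0 = S0" using t_0 by (simp add: S_def)
  have p_mem: "s \<in> p n s" and p_conn: "connected_set E (p n s)" and p_V: "p n s \<subseteq> V - F n"
    and p_S: "p n s \<inter> S (Suc n) \<noteq> {}" if "s \<in> S n" for n s
    using p(1)[of n] that by (auto simp: linked_def)
  have p_dis: "x = y" if "v \<in> p n x" "v \<in> p n y" "x \<in> S n" "y \<in> S n" for n x y v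
    using p(1)[of n] that unfolding linked_def by (meson disjoint_family_onD disjoint_iff)
  have S_new: "S (Suc n) \<inter> (F n \<union> S n) = {}" for n
    using p(1)[of n] by (auto simp: linked_def)
  define \<sigma> where "\<sigma> n s = (SOME u. u \<in> p n s \<inter> S (Suc n))" for n s
  have \<sigma>: "\<sigma> n s \<in> p n s" "\<sigma> n s \<in> S (Suc n)" if "s \<in> S n" for n s
    using some_in_eq[of "p n s \<inter> S (Suc n)"] p_S[OF that] by (auto simp: \<sigma>_def)
  define c where "c s = rec_nat s \<sigma>" for s
  have c_0: "c s 0 = s" and c_Suc: "c s (Suc n) = \<sigma> n (c s n)" for s n
    by (auto simp: c_def)
  have c_S: "c s n \<in> S n" if "s \<in> S0" for s n
    using that by (induction n) (auto simp: c_0 c_Suc S0 \<sigma>)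
  have c_inj: "x = y" if "c x n = c y n" "x \<in> S0" "y \<in> S0" for x y n
    using that
  proof (induction n)
    case 0
    then show ?case by (simp add: c_0)
  next
    case (Suc n)
    then show ?case using \<sigma>(1) c_S p_dis by (metis c_Suc)
  qed
  define U where "U n = (\<Union>s\<in>S n. p n s)" for n
  have U_F: "U n \<inter> F n = {}" for n using p_V by (fastforce simp: U_def)
  have S_U: "S n \<subseteq> U n" for n using p_mem by (auto simp: U_def)
  have F_Suc: "F (Suc n) = F n \<union> U n - S (Suc n)" for n using p(2) by (simp add: U_def)
  have F_mono: "F m \<subseteq> F n" if "m \<le> n" for m n
    using that by (induction rule: dec_induct) (use F_Suc S_new in blast)+
  have U_far: "U m \<inter> U n = {}" if "Suc m < n" for m n
  proof -
    have "U m \<subseteq> F (Suc m) \<union> S (Suc m)" using F_Suc[of m] by blast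
    also have "S (Suc m) \<subseteq> F (Suc (Suc m))"
      using F_Suc[of "Suc m"] S_new[of "Suc m"] S_U[of "Suc m"] by blast
    finally have "U m \<subseteq> F n"
      using F_mono[of "Suc m" n] F_mono[of "Suc (Suc m)" n] that by auto
    then show ?thesis using U_F[of n] by auto
  qed
  have U_next: "U m \<inter> U (Suc m) \<subseteq> S (Suc m)" for m
    using F_Suc[of m] U_F[of "Suc m"] by blast
  define W where "W s n = p n (c s n)" for s n
  have W_U: "W s n \<subseteq> U n" if "s \<in> S0" for s n
    using c_S[OF that] by (auto simp: W_def U_def)
  have W_dis_le: "x = y" if xy: "x \<in> S0" "y \<in> S0" "v \<in> W x m" "v \<in> W y n" "m \<le> n" for x y v m n
  proof -
    have vU: "v \<in> U m" "v \<in> U n" using xy W_U by auto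
    then have "\<not> Suc m < n" using U_far[of m n] by blast
    then consider "n = m" | "n = Suc m" using xy(5) by linarith
    then show ?thesis
    proof cases
      case 1
      then have "c x m = c y m"
        using xy c_S p_dis by (metis W_def)
      then show ?thesis using c_inj xy by blast
    next
      case 2
      then have "v \<in> S (Suc m)" using U_next vU by blast
      moreover have "v \<in> p (Suc m) (c y (Suc m))" using xy 2 by (simp add: W_def)
      ultimately have "v = c y (Suc m)"
        using p_mem p_dis c_S xy(2) by blast
      then have "v \<in> p m (c y m)" using \<sigma>(1)[OF c_S[OF xy(2)]] by (simp add: c_Suc)
      then have "c x m = c y m" using xy c_S p_dis by (metis W_def)
      then show ?thesis using c_inj xy by blast
    qed
  qed
  have W_dis: "x = y" if "x \<in> S0" "y \<in> S0" "v \<in> W x m" "v \<in> W y n" for x y v m n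
    using W_dis_le that by (metis nat_le_linear)
  have "\<exists>R \<in> rays V E. range R \<subseteq> (\<Union>n. W s n)" if s: "s \<in> S0" for s
  proof (rule ray_from_unbounded_chain[OF assms(1)])
    show "connected_set E (W s n)" for n
      using p_conn c_S[OF s] by (simp add: W_def)
    show "W s n \<inter> W s (Suc n) \<noteq> {}" for n
    proof -
      have "c s (Suc n) \<in> p n (c s n)" using \<sigma>(1)[OF c_S[OF s]] by (simp add: c_Suc)
      then show ?thesis using p_mem[OF c_S[OF s]] by (auto simp: W_def)
    qed
    show "W s n \<subseteq> V" for n
      using p_V[OF c_S[OF s]] by (auto simp: W_def)
    show "finite {n. v \<in> W s n}" for v
    proof (cases "\<exists>m. v \<in> W s m")
      case True
      then obtain m where "v \<in> W s m" by blast
      then have "n \<le> Suc m" if "v \<in> W s n" for n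
        using that W_U[OF s] U_far[of m n] by (meson disjoint_iff not_le subsetD)
      then show ?thesis by (auto intro: finite_subset[of _ "{..Suc m}"])
    qed auto
  qed
  then obtain r where r: "\<And>s. s \<in> S0 \<Longrightarrow> r s \<in> rays V E \<and> range (r s) \<subseteq> (\<Union>n. W s n)"
    by metis
  have "disjoint_family_on (\<lambda>s. range (r s)) S0"
    unfolding disjoint_family_on_def
  proof (intro ballI impI equals0I)
    fix x y v assume xy: "x \<in> S0" "y \<in> S0" "x \<noteq> y" and v: "v \<in> range (r x) \<inter> range (r y)"
    then obtain m n where "v \<in> W x m" "v \<in> W y n" using r by blast
    then show False using W_dis xy by blast
  qed
  then show ?thesis using r by blast
qed

section \<open>The two sides of a finite vertex set\<close>

text \<open>A graph all of whose rays are equivalent to the ray \<open>R0\<close>.\<close>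

locale one_end =
  fixes V :: "'a set" and E :: "'a \<Rightarrow> 'a \<Rightarrow> bool" and R0 :: "nat \<Rightarrow> 'a"
  assumes sym: "symp E" and irrefl: "\<And>u. \<not> E u u"
    and ray: "R0 \<in> rays V E"
    and equiv: "\<And>Q S. Q \<in> rays V E \<Longrightarrow> finite S \<Longrightarrow>
      \<exists>n. \<forall>i\<ge>n. \<forall>j\<ge>n. (Q i, R0 j) \<in> connected_in (V - S) E"
begin

text \<open>
  For finite \<open>S\<close>, \<open>far S\<close> is the component of \<open>V - S\<close> in which the end lives, and \<open>near S\<close> is what \<open>S\<close>
  encloses, that is, cuts off from the end. The set \<open>near S\<close> may be infinite.
\<close>

definition far :: "'a set \<Rightarrow> 'a set" where
  "far S = {v. \<exists>n. \<forall>j\<ge>n. (v, R0 j) \<in> connected_in (V - S) E}"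

definition near :: "'a set \<Rightarrow> 'a set" where
  "near S = V - S - far S"

text \<open>
  \<open>S\<close> is finite, and all its vertices have a neighbour on the side of the end.
\<close>

definition tight :: "'a set \<Rightarrow> bool" where
  "tight S \<longleftrightarrow> finite S \<and> S \<subseteq> V \<and> (\<forall>s\<in>S. \<exists>c\<in>far S. E s c)"

lemma E_sym: "E u v \<Longrightarrow> E v u"
  using sym by (auto simp: symp_def)

lemma far_subset: "far S \<subseteq> V - S"
  by (auto simp: far_def dest: connected_in_memD)

lemma far_near_disjoint: "far S \<inter> near S = {}" "S \<inter> near S = {}" "S \<inter> far S = {}"
  using far_subset[of S] by (auto simp: near_def)

lemma side_cases: "v \<in> V \<Longrightarrow> v \<in> S \<or> v \<in> far S \<or> v \<in> near S"
  by (auto simp: near_def)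

lemma ray_tail_in_far:
  assumes "Q \<in> rays V E" "finite S"
  shows "\<exists>n. \<forall>i\<ge>n. Q i \<in> far S"
  using equiv[OF assms] by (auto simp: far_def)

lemma far_edge:
  assumes "v \<in> far S" "E v u" "u \<in> V" "u \<notin> S"
  shows "u \<in> far S"
proof -
  obtain n where n: "\<And>j. j \<ge> n \<Longrightarrow> (v, R0 j) \<in> connected_in (V - S) E"
    using assms(1) by (auto simp: far_def)
  have "(u, v) \<in> connected_in (V - S) E"
    using assms far_subset[of S] E_sym by (intro connected_in_edge) auto
  then show ?thesis using n by (auto simp: far_def intro: connected_in_trans)
qed

lemma near_edge:
  assumes "v \<in> near S" "E v u" "u \<in> V" "u \<notin> S"
  shows "u \<in> near S"
  using assms far_edge[of u S v] E_sym by (auto simp: near_def)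

lemma near_far_no_edge: "v \<in> near S \<Longrightarrow> u \<in> far S \<Longrightarrow> \<not> E v u"
  using near_edge[of v S u] far_subset[of S] far_near_disjoint[of S] by blast

lemma far_connected: "connected_set E (far S)"
  unfolding connected_set_def
proof (intro ballI)
  fix x y assume x: "x \<in> far S" and y: "y \<in> far S"
  then obtain m n where "\<And>j. j \<ge> m \<Longrightarrow> (x, R0 j) \<in> connected_in (V - S) E"
      "\<And>j. j \<ge> n \<Longrightarrow> (y, R0 j) \<in> connected_in (V - S) E"
    by (auto simp: far_def)
  then have "(x, R0 (max m n)) \<in> connected_in (V - S) E" "(y, R0 (max m n)) \<in> connected_in (V - S) E"
    by auto
  then have "(x, y) \<in> connected_in (V - S) E"
    by (meson connected_in_sym[OF sym] connected_in_trans)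
  then have "(x, y) \<in> connected_in {u. (x, u) \<in> connected_in (V - S) E} E"
    by (rule connected_in_reachable)
  moreover have "{u. (x, u) \<in> connected_in (V - S) E} \<subseteq> far S"
    using connected_in_closed[of x _ "V - S" E "far S"] x far_edge by fastforce
  ultimately show "(x, y) \<in> connected_in (far S) E"
    by (rule connected_in_mono)
qed

lemma far_subset_closed:
  assumes "x \<in> far S" "x \<in> K"
    and "\<And>k u. k \<in> K \<Longrightarrow> k \<in> far S \<Longrightarrow> u \<in> far S \<Longrightarrow> E k u \<Longrightarrow> u \<in> K"
  shows "far S \<subseteq> K"
proof
  fix y assume "y \<in> far S"
  then have "(x, y) \<in> connected_in (far S) E"
    using far_connected assms(1) by (intro connected_setD)
  then show "y \<in> K" using assms(2,3) by (rule connected_in_closed)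
qed

lemma common_far:
  assumes "finite S" "finite T"
  shows "far S \<inter> far T \<noteq> {}"
proof -
  obtain m n where "\<forall>i\<ge>m. R0 i \<in> far S" "\<forall>i\<ge>n. R0 i \<in> far T"
    using ray_tail_in_far[OF ray] assms by meson
  then have "R0 (max m n) \<in> far S \<inter> far T" by auto
  then show ?thesis by blast
qed

lemma far_subset_if_avoids:
  assumes "finite S" "finite T" "S \<inter> far T = {}"
  shows "far T \<subseteq> far S"
proof -
  obtain x where "x \<in> far T" "x \<in> far S" using common_far[OF assms(1,2)] by blast
  then show ?thesis
    using far_edge far_subset[of T] assms(3) by (intro far_subset_closed[of x]) blast+
qed

lemma far_antimono: "S \<subseteq> T \<Longrightarrow> far T \<subseteq> far S"
  unfolding far_def by (blast intro: connected_in_mono[of _ _ "V - T" E])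

lemma tight_refinement:
  assumes "finite S" "S \<subseteq> V"
  shows "\<exists>T\<subseteq>S. tight T \<and> far T = far S \<and> near S \<subseteq> near T"
proof -
  define T where "T = {s \<in> S. \<exists>c\<in>far S. E s c}"
  have TS: "T \<subseteq> S" by (auto simp: T_def)
  obtain x where x: "x \<in> far T" "x \<in> far S"
    using common_far[of T S] assms(1) finite_subset[OF TS] by blast
  have "far T \<subseteq> far S"
  proof (rule far_subset_closed[OF x])
    fix k u assume k: "k \<in> far S" "u \<in> far T" "E k u"
    then have "u \<notin> S" using far_subset[of T] E_sym by (auto simp: T_def)
    then show "u \<in> far S" using k far_subset[of T] far_edge by blast
  qed
  then have eq: "far T = far S" using far_antimono[OF TS] by blast
  have "tight T" using eq TS assms finite_subset[OF TS] by (auto simp: tight_def T_def)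
  moreover have "near S \<subseteq> near T" using eq TS by (auto simp: near_def)
  ultimately show ?thesis using TS eq by blast
qed

text \<open>
  Tightness of \<open>T\<close> ensures that no vertex of \<open>T\<close> is in \<open>near S\<close>.
\<close>

lemma near_mono:
  assumes "finite S" "tight T" "S \<inter> far T = {}"
  shows "far T \<subseteq> far S" "near S \<subseteq> near T"
proof -
  show far: "far T \<subseteq> far S"
    using assms by (intro far_subset_if_avoids) (auto simp: tight_def)
  have "t \<notin> near S" if t: "t \<in> T" for t
  proof -
    obtain c where "c \<in> far T" "E t c" using assms(2) t by (auto simp: tight_def)
    then show ?thesis using far near_far_no_edge by blast
  qed
  then show "near S \<subseteq> near T" using far by (auto simp: near_def)
qed

lemma tight_Un_far_connected:
  assumes "tight S" "x \<in> S \<union> far S" "y \<in> S \<union> far S"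
  shows "(x, y) \<in> connected_in (S \<union> far S) E"
proof -
  have "\<exists>c\<in>far S. (x, c) \<in> connected_in (S \<union> far S) E" if "x \<in> S \<union> far S" for x
    using that
  proof
    assume "x \<in> S"
    then obtain c where "c \<in> far S" "E x c" using assms(1) by (auto simp: tight_def)
    then show ?thesis using that by (intro bexI[of _ c] connected_in_edge) auto
  next
    assume "x \<in> far S"
    then show ?thesis by (intro bexI[of _ x] connected_in_refl) auto
  qed
  then obtain c d where cd: "c \<in> far S" "(x, c) \<in> connected_in (S \<union> far S) E"
      "d \<in> far S" "(y, d) \<in> connected_in (S \<union> far S) E"
    using assms(2,3) by meson
  have "(c, d) \<in> connected_in (S \<union> far S) E"
    using cd by (intro connected_set_subset_in[OF far_connected]) auto
  then show ?thesis
    using cd(2) connected_in_sym[OF sym cd(4)] by (meson connected_in_trans)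
qed

lemma automorphism_connected_in:
  assumes f: "graph_automorphism V E f" and "W \<subseteq> V" "(x, y) \<in> connected_in W E"
  shows "(f x, f y) \<in> connected_in (f ` W) E"
  using assms(3)
proof (induction rule: connected_in_induct)
  case base
  then show ?case by (auto intro: connected_in_refl)
next
  case (step u v)
  then have "E (f u) (f v)" using f assms(2) by (auto simp: graph_automorphism_def)
  then show ?case using step
    by (intro connected_in_trans[OF step.IH] connected_in_edge) auto
qed

lemma automorphism_connected_set:
  assumes "graph_automorphism V E f" "W \<subseteq> V" "connected_set E W"
  shows "connected_set E (f ` W)"
  using automorphism_connected_in[OF assms(1,2)] assms(3) by (auto simp: connected_set_def)

lemma automorphism_inv:
  assumes "graph_automorphism V E f"
  shows "graph_automorphism V E (inv_into V f)"
proof -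
  have f: "bij_betw f V V" "\<And>x y. x \<in> V \<Longrightarrow> y \<in> V \<Longrightarrow> E (f x) (f y) = E x y"
    using assms by (auto simp: graph_automorphism_def)
  have "bij_betw (inv_into V f) V V" using f(1) by (rule bij_betw_inv_into)
  moreover have "E (inv_into V f x) (inv_into V f y) = E x y" if "x \<in> V" "y \<in> V" for x y
    using f(2)[of "inv_into V f x" "inv_into V f y"] that f(1) bij_betw_inv_into_right[OF f(1)]
      bij_betwE[OF \<open>bij_betw (inv_into V f) V V\<close>] by auto
  ultimately show ?thesis by (auto simp: graph_automorphism_def)
qed

text \<open>
  An automorphism maps \<open>R0\<close> to a ray which is equivalent to \<open>R0\<close>, and so preserves the end.
\<close>

lemma automorphism_far:
  assumes f: "graph_automorphism V E f" and S: "finite S" "S \<subseteq> V"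
  shows "far (f ` S) = f ` far S"
proof -
  have sub: "g ` far T \<subseteq> far (g ` T)"
    if g: "graph_automorphism V E g" and T: "finite T" "T \<subseteq> V" for g T
  proof
    fix y assume "y \<in> g ` far T"
    then obtain v n where v: "y = g v" "\<And>j. j \<ge> n \<Longrightarrow> (v, R0 j) \<in> connected_in (V - T) E"
      by (auto simp: far_def)
    have bij: "bij_betw g V V" using g by (auto simp: graph_automorphism_def)
    have "g ` (V - T) = V - g ` T"
      using bij T(2) inj_on_image_set_diff[of g V V T] by (auto simp: bij_betw_def)
    then have *: "(y, g (R0 j)) \<in> connected_in (V - g ` T) E" if "j \<ge> n" for j
      using automorphism_connected_in[OF g _ v(2)[OF that]] by (simp add: v(1))
    have R0: "range R0 \<subseteq> V" "inj R0" "\<And>n. E (R0 n) (R0 (Suc n))"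
      using ray by (auto simp: rays_def)
    have "(\<lambda>j. g (R0 j)) \<in> rays V E"
    proof (rule rayI)
      show "range (\<lambda>j. g (R0 j)) \<subseteq> V" using R0(1) bij by (auto simp: bij_betw_def)
      show "inj (\<lambda>j. g (R0 j))"
        using comp_inj_on[OF R0(2) inj_on_subset[OF _ R0(1)], of g] bij by (simp add: bij_betw_def comp_def)
      show "E (g (R0 n)) (g (R0 (Suc n)))" for n
        using range_subsetD[OF R0(1)] R0(3) g by (simp add: graph_automorphism_def)
    qed
    from ray_tail_in_far[OF this finite_imageI[OF T(1)], of g]
    obtain m where m: "\<And>i. i \<ge> m \<Longrightarrow> g (R0 i) \<in> far (g ` T)" by blast
    have "(g (R0 (max m n)), y) \<in> connected_in (V - g ` T) E"
      by (rule connected_in_sym[OF sym *]) simp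
    then show "y \<in> far (g ` T)"
      by (rule connected_in_closed[OF _ m]) (use far_edge in auto)
  qed
  let ?h = "inv_into V f"
  have bij: "bij_betw f V V" using f by (auto simp: graph_automorphism_def)
  have fS: "f ` S \<subseteq> V" using bij S(2) by (auto simp: bij_betw_def)
  have "?h ` f ` S = S" using bij S(2) by (simp add: bij_betw_def)
  then have "?h ` far (f ` S) \<subseteq> far S"
    using sub[OF automorphism_inv[OF f] finite_imageI[OF S(1)] fS] by simp
  then have "f ` ?h ` far (f ` S) \<subseteq> f ` far S" by blast
  moreover have "f ` ?h ` far (f ` S) = far (f ` S)"
    using bij far_subset[of "f ` S"] by (intro image_inv_into_cancel[of f V V]) (auto simp: bij_betw_def)
  ultimately show ?thesis using sub[OF f S] by blast
qed

lemma automorphism_near: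
  assumes f: "graph_automorphism V E f" and S: "finite S" "S \<subseteq> V"
  shows "near (f ` S) = f ` near S"
proof -
  have f_V: "inj_on f V" "f ` V = V" using f by (auto simp: graph_automorphism_def bij_betw_def)
  have "f ` (V - S - far S) = V - f ` S - f ` far S"
    using S far_subset[of S] inj_on_image_set_diff[OF f_V(1), of V S] f_V(2)
      inj_on_image_set_diff[OF f_V(1), of "V - S" "far S"] by auto
  then show ?thesis by (simp add: near_def automorphism_far[OF f S])
qed

lemma automorphism_tight:
  assumes f: "graph_automorphism V E f" and S: "tight S"
  shows "tight (f ` S)"
proof -
  have S': "finite S" "S \<subseteq> V" using S by (auto simp: tight_def)
  have "f ` V = V" using f by (auto simp: graph_automorphism_def bij_betw_def)
  moreover have "\<exists>c\<in>f ` far S. E (f s) c" if "s \<in> S" for s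
    using that S S' f far_subset[of S] unfolding tight_def graph_automorphism_def by blast
  ultimately show ?thesis
    using S' unfolding tight_def automorphism_far[OF f S'] by auto
qed

lemma disjoint_rays_family:
  assumes "finite S" "\<forall>s\<in>S. r s \<in> rays V E" "disjoint_family_on (\<lambda>s. range (r s)) S" "n \<le> card S"
  shows "\<exists>F. disjoint_rays_in (rays V E) F \<and> finite F \<and> card F = n"
proof -
  obtain S' where S': "S' \<subseteq> S" "card S' = n" "finite S'"
    using obtain_subset_with_card_n[OF assms(4)] by metis
  have dis: "range (r x) \<inter> range (r y) = {}" if "x \<in> S'" "y \<in> S'" "x \<noteq> y" for x y
    using that S'(1) by (intro disjoint_family_onD[OF assms(3)]) auto
  have "inj_on r S'"
  proof (rule inj_onI, rule ccontr)
    fix x y assume "x \<in> S'" "y \<in> S'" "r x = r y" "x \<noteq> y"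
    then show False using dis[of x y] by auto
  qed
  then have "card (r ` S') = n" using S' by (simp add: card_image)
  moreover have "disjoint_family_on range (r ` S')"
    unfolding disjoint_family_on_def using dis by blast
  moreover have "r ` S' \<subseteq> rays V E" using S' assms(2) by blast
  ultimately show ?thesis
    using S'(3) by (intro exI[of _ "r ` S'"]) (simp add: disjoint_rays_in_def)
qed

section \<open>Dominating vertices\<close>

text \<open>
  No finite set of other vertices cuts \<open>v\<close> off from the end.
\<close>

definition dominating :: "'a \<Rightarrow> bool" where
  "dominating v \<longleftrightarrow> v \<in> V \<and> (\<forall>S. finite S \<longrightarrow> v \<notin> S \<longrightarrow> v \<in> far S)"

lemma dominatingD: "dominating v \<Longrightarrow> finite S \<Longrightarrow> v \<notin> S \<Longrightarrow> v \<in> far S"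
  by (simp add: dominating_def)

lemma disjoint_rays_if_infinitely_many_dominating:
  assumes inf: "infinite {v. dominating v}"
  shows "\<exists>F. disjoint_rays_in (rays V E) F \<and> finite F \<and> card F = n"
proof -
  let ?D = "{v. dominating v}"
  define I where "I F S \<longleftrightarrow> finite F \<and> finite S \<and> S \<subseteq> ?D \<and> card S = n \<and> F \<inter> S = {}" for F S
  have fresh: "\<exists>S. finite S \<and> S \<subseteq> ?D - X \<and> card S = n" if "finite X" for X
    using infinite_arbitrarily_large[OF Diff_infinite_finite[OF that inf]] by blast
  obtain S0 where S0: "finite S0" "S0 \<subseteq> ?D" "card S0 = n"
    using fresh[of "{}"] by auto
  have step: "\<exists>p S'. linked V E F S S' p \<and> I ((F \<union> (\<Union>s\<in>S. p s)) - S') S'" if "I F S" for F S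
  proof -
    have FS: "finite F" "finite S" "S \<subseteq> ?D" "card S = n" "F \<inter> S = {}"
      using that by (auto simp: I_def)
    obtain S' where S': "finite S'" "S' \<subseteq> ?D - (F \<union> S)" "card S' = n"
      using fresh[of "F \<union> S"] FS by auto
    have small: "card S \<le> card Z" if Z: "finite Z" "separates E (V - F) S S' Z" for Z
    proof (rule ccontr)
      assume less: "\<not> card S \<le> card Z"
      then have "\<not> S \<subseteq> Z" "\<not> S' \<subseteq> Z"
        using card_mono[OF Z(1), of S] card_mono[OF Z(1), of S'] FS(4) S'(3) by auto
      then obtain s s' where s: "s \<in> S" "s \<notin> Z" "s' \<in> S'" "s' \<notin> Z" by blast
      have "dominating s" "s \<notin> F \<union> Z" "dominating s'" "s' \<notin> F \<union> Z" "finite (F \<union> Z)"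
        using s FS S' Z(1) by auto
      then have "s \<in> far (F \<union> Z)" "s' \<in> far (F \<union> Z)"
        by (auto intro!: dominatingD)
      then have "(s, s') \<in> connected_in (V - F - Z) E"
        using far_subset[of "F \<union> Z"] by (intro connected_set_subset_in[OF far_connected]) auto
      then show False using Z(2) s by (auto simp: separates_def)
    qed
    have "\<exists>p. disjoint_family_on p S \<and>
        (\<forall>s\<in>S. s \<in> p s \<and> finite (p s) \<and> p s \<subseteq> V - F \<and> connected_set E (p s) \<and> p s \<inter> S' \<noteq> {})"
      by (rule menger_linkage[OF sym irrefl FS(2)]) (rule small)
    then obtain p where p: "disjoint_family_on p S"
        "\<forall>s\<in>S. s \<in> p s \<and> finite (p s) \<and> p s \<subseteq> V - F \<and> connected_set E (p s) \<and> p s \<inter> S' \<noteq> {}"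
      by (elim exE conjE)
    have "linked V E F S S' p" using p S'(2) by (auto simp: linked_def)
    moreover have "I ((F \<union> (\<Union>s\<in>S. p s)) - S') S'"
      using FS S' p by (auto simp: I_def)
    ultimately show ?thesis by blast
  qed
  have "I {} S0" using S0 by (simp add: I_def)
  with step have "\<exists>r. (\<forall>s\<in>S0. r s \<in> rays V E) \<and> disjoint_family_on (\<lambda>s. range (r s)) S0"
    by (rule disjoint_rays_from_linkages[OF sym])
  then obtain r where "\<forall>s\<in>S0. r s \<in> rays V E" "disjoint_family_on (\<lambda>s. range (r s)) S0"
    by (elim exE conjE)
  then show ?thesis using S0 by (intro disjoint_rays_family[of S0 r]) simp_all
qed

end

section \<open>Separators in graphs without dominating vertices\<close>

text \<open>
  A connected graph with one end in which every vertex is enclosed by a finite set, that is, no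
  vertex is dominating.
\<close>

locale undominated = one_end +
  assumes connected: "connected_set E V"
    and undominated: "\<And>v. v \<in> V \<Longrightarrow> \<exists>S. finite S \<and> S \<subseteq> V \<and> v \<in> near S"
begin

lemma near_empty: "near {} = {}"
proof -
  have "V \<subseteq> far {}"
  proof
    fix v assume "v \<in> V"
    moreover have "R0 j \<in> V" for j using ray by (auto simp: rays_def)
    ultimately show "v \<in> far {}"
      using connected by (auto simp: far_def intro: connected_setD)
  qed
  then show ?thesis by (auto simp: near_def)
qed

lemma finite_set_enclosed:
  assumes X: "finite X" "X \<subseteq> V"
  shows "\<exists>T. tight T \<and> X \<subseteq> near T"
proof -
  have "\<forall>x\<in>X. \<exists>S. finite S \<and> S \<subseteq> V \<and> x \<in> near S" using undominated X by blast
  then obtain s where s: "\<And>x. x \<in> X \<Longrightarrow> finite (s x) \<and> s x \<subseteq> V \<and> x \<in> near (s x)" by metis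
  define S where "S = (\<Union>x\<in>X. s x) - X"
  have S: "finite S" "S \<subseteq> V" using X s by (auto simp: S_def)
  \<comment> \<open>From the last vertex \<open>u \<in> X\<close> on a path to the end, the set \<open>s u\<close> would still have to be met.\<close>
  have "far S \<subseteq> far (S \<union> X)"
  proof -
    obtain x where x: "x \<in> far (S \<union> X)" using common_far[of "S \<union> X" "S \<union> X"] S X by blast
    then have "x \<in> far S" using far_antimono[of S "S \<union> X"] by blast
    then show ?thesis using x
    proof (rule far_subset_closed)
      fix k u assume k: "k \<in> far (S \<union> X)" "u \<in> far S" "E k u"
      have "u \<notin> X"
      proof
        assume u: "u \<in> X"
        have "s u \<subseteq> S \<union> X" using u by (auto simp: S_def)
        then have "k \<in> far (s u)" using k(1) far_antimono by blast
        moreover have "u \<in> near (s u)" using s u by blast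
        ultimately show False using near_far_no_edge k(3) E_sym by blast
      qed
      moreover have "u \<in> V" "u \<notin> S" using subsetD[OF far_subset k(2)] by auto
      ultimately show "u \<in> far (S \<union> X)" using far_edge[OF k(1,3)] by blast
    qed
  qed
  then have "X \<inter> far S = {}" using far_subset[of "S \<union> X"] by blast
  then have "X \<subseteq> near S" using X by (auto simp: near_def S_def)
  then show ?thesis using tight_refinement[OF S] by blast
qed

text \<open>
  Minimality of \<open>S\<close> is asked for among the sets that cut off \<open>S\<close> itself. By Menger's theorem \<open>S\<close> can
  then be linked to every enclosure of this kind farther out.
\<close>

definition minimal :: "'a set \<Rightarrow> bool" where
  "minimal S \<longleftrightarrow> tight S \<and> (\<forall>Z. finite Z \<longrightarrow> S \<inter> far Z = {} \<longrightarrow> card S \<le> card Z)"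

lemma far_Int_V: "far (Z \<inter> V) = far Z"
proof -
  have "V - Z \<inter> V = V - Z" by auto
  then show ?thesis by (simp add: far_def)
qed

lemma finite_set_enclosed_minimal:
  assumes X: "finite X" "X \<subseteq> V"
  shows "\<exists>S. minimal S \<and> X \<subseteq> near S"
proof -
  obtain T where T: "tight T" "X \<subseteq> near T" using finite_set_enclosed[OF X] by blast
  then have finT: "finite T" "T \<subseteq> V" by (auto simp: tight_def)
  let ?P = "\<lambda>Z. finite Z \<and> T \<inter> far Z = {}"
  have "?P T" using finT far_subset[of T] by blast
  then obtain S1 where S1: "?P S1" "\<And>Z. ?P Z \<Longrightarrow> card S1 \<le> card Z"
    using ex_has_least_nat[of ?P T card] by blast
  obtain S where S: "S \<subseteq> S1 \<inter> V" "tight S" "far S = far S1"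
    using tight_refinement[of "S1 \<inter> V"] S1(1) by (auto simp: far_Int_V)
  have card: "card S \<le> card S1" using S(1) S1(1) by (intro card_mono) auto
  have T_far: "T \<inter> far S = {}" using S1(1) S(3) by simp
  have "minimal S"
    unfolding minimal_def
  proof (intro conjI allI impI)
    show "tight S" by (rule S(2))
    fix Z assume Z: "finite Z" "S \<inter> far Z = {}"
    have "far Z \<subseteq> far S" using S(2) Z by (intro far_subset_if_avoids) (auto simp: tight_def)
    then have "?P Z" using Z T_far by blast
    then show "card S \<le> card Z" using S1(2) card by (meson order_trans)
  qed
  moreover have "near T \<subseteq> near S" by (rule near_mono[OF finT(1) S(2) T_far])
  ultimately show ?thesis using T(2) by blast
qed

text \<open>
  A set separating \<open>S\<close> from \<open>S'\<close> in the region between them cuts off \<open>S\<close> from the end.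
\<close>

lemma minimal_linked:
  assumes S: "minimal S" and S': "tight S'" "S \<subseteq> near S'"
  shows "\<exists>p. disjoint_family_on p S \<and> (\<forall>s\<in>S. s \<in> p s \<and> finite (p s) \<and>
           p s \<subseteq> S' \<union> near S' - near S \<and> connected_set E (p s) \<and> p s \<inter> S' \<noteq> {})"
proof (rule menger_linkage[OF sym irrefl])
  have fin: "finite S" "finite S'" "S \<subseteq> V" "S' \<subseteq> V" "tight S"
    using S S' by (auto simp: minimal_def tight_def)
  show "finite S" by (rule fin)
  fix Z assume Z: "finite Z" "separates E (S' \<union> near S' - near S) S S' Z"
  let ?U = "S' \<union> near S' - near S"
  have "S \<inter> far S' = {}" using S'(2) far_near_disjoint[of S'] by blast
  then have mono: "far S' \<subseteq> far S" by (rule near_mono(1)[OF fin(1) S'(1)])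
  \<comment> \<open>No edge leads from what is not reached from \<open>S\<close> in \<open>?U\<close> outside \<open>Z\<close> to another vertex of
      \<open>far Z\<close>.\<close>
  let ?K = "far S' \<union> {v \<in> ?U - Z. \<forall>s\<in>S. (s, v) \<notin> connected_in (?U - Z) E}"
  obtain x where x: "x \<in> far Z" "x \<in> far S'" using common_far[OF Z(1) fin(2)] by blast
  have "far Z \<subseteq> ?K"
  proof (rule far_subset_closed[OF x(1)])
    show "x \<in> ?K" using x by blast
    fix k u assume k: "k \<in> ?K" "k \<in> far Z" "u \<in> far Z" "E k u"
    have u: "u \<in> V" "u \<notin> Z" and kZ: "k \<in> V" "k \<notin> Z" using k(2,3) far_subset[of Z] by auto
    show "u \<in> ?K"
    proof (cases "u \<in> far S'")
      case False
      have kU: "k \<in> far S' \<or> k \<in> ?U \<and> (\<forall>s\<in>S. (s, k) \<notin> connected_in (?U - Z) E)"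
        using k(1) by blast
      have "u \<notin> near S"
      proof
        assume uS: "u \<in> near S"
        show False
        proof (cases "k \<in> far S'")
          case True
          then show False using mono uS near_far_no_edge E_sym k(4) by blast
        next
          case False
          then have "k \<notin> near S" using kU by blast
          moreover have "k \<in> S \<or> k \<in> near S" using near_edge[OF uS E_sym[OF k(4)] kZ(1)] by blast
          ultimately have "k \<in> S" by blast
          then show False using kU False kZ connected_in_refl[of k "?U - Z" E] by blast
        qed
      qed
      then have uU: "u \<in> ?U" using False side_cases[OF u(1), of S'] by blast
      have "(s, u) \<notin> connected_in (?U - Z) E" if s: "s \<in> S" for s
      proof
        assume su: "(s, u) \<in> connected_in (?U - Z) E"
        show False
        proof (cases "k \<in> far S'")
          case True
          then have "u \<in> S'" using False far_edge[OF True k(4) u(1)] by blast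
          then show False using su Z(2) s by (auto simp: separates_def)
        next
          case False
          then have "(u, k) \<in> connected_in (?U - Z) E"
            using kU uU u kZ E_sym[OF k(4)] by (intro connected_in_edge) blast+
          then show False using su kU False s connected_in_trans[OF su] by blast
        qed
      qed
      then show ?thesis using uU u(2) by blast
    qed blast
  qed
  moreover have "S \<inter> ?K = {}"
  proof -
    have "s \<notin> ?K" if s: "s \<in> S" for s
    proof
      assume "s \<in> ?K"
      moreover have "s \<notin> far S'" using s \<open>S \<inter> far S' = {}\<close> by blast
      ultimately have "s \<in> ?U - Z" "(s, s) \<notin> connected_in (?U - Z) E" using s by blast+
      then show False using connected_in_refl by metis
    qed
    then show ?thesis by blast
  qed
  ultimately have "S \<inter> far Z = {}" by blast
  then show "card S \<le> card Z" using S Z(1) by (auto simp: minimal_def)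
qed

text \<open>
  The strands of rays start in \<open>S0\<close> and pass through a sequence of minimal sets, each one enclosing the
  previous one. The vertices used up stay in the part enclosed by the current set.
\<close>

lemma disjoint_rays_if_large_minimal:
  assumes "minimal S0" "n \<le> card S0"
  shows "\<exists>F. disjoint_rays_in (rays V E) F \<and> finite F \<and> card F = n"
proof -
  define I where "I F S \<longleftrightarrow> minimal S \<and> F \<subseteq> near S" for F S
  have step: "\<exists>p S'. linked V E F S S' p \<and> I ((F \<union> (\<Union>s\<in>S. p s)) - S') S'" if "I F S" for F S
  proof -
    have S: "minimal S" "F \<subseteq> near S" "finite S" "S \<subseteq> V"
      using that by (auto simp: I_def minimal_def tight_def)
    obtain S' where S': "minimal S'" "S \<subseteq> near S'"
      using finite_set_enclosed_minimal[OF S(3,4)] by blast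
    have tight: "tight S'" using S'(1) by (simp add: minimal_def)
    have "near S \<subseteq> near S'"
      using near_mono(2)[OF S(3) tight] S'(2) far_near_disjoint[of S'] by blast
    then have F: "F \<subseteq> near S'" using S(2) by blast
    obtain p where p: "disjoint_family_on p S"
        "\<forall>s\<in>S. s \<in> p s \<and> finite (p s) \<and> p s \<subseteq> S' \<union> near S' - near S \<and> connected_set E (p s) \<and> p s \<inter> S' \<noteq> {}"
      using minimal_linked[OF S(1) tight S'(2)] by (elim exE conjE)
    have "near S' \<subseteq> V" "S' \<subseteq> V" using tight by (auto simp: near_def tight_def)
    then have "p s \<subseteq> V - F" if "s \<in> S" for s
      using bspec[OF p(2) that] S(2) by blast
    moreover have "S' \<inter> (F \<union> S) = {}" using F S'(2) far_near_disjoint[of S'] by blast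
    ultimately have "linked V E F S S' p" using p by (simp add: linked_def)
    moreover have "I ((F \<union> (\<Union>s\<in>S. p s)) - S') S'"
      using F p(2) S'(1) by (auto simp: I_def)
    ultimately show ?thesis by blast
  qed
  have "I {} S0" using assms(1) by (simp add: I_def)
  with step have "\<exists>r. (\<forall>s\<in>S0. r s \<in> rays V E) \<and> disjoint_family_on (\<lambda>s. range (r s)) S0"
    by (rule disjoint_rays_from_linkages[OF sym])
  then obtain r where "\<forall>s\<in>S0. r s \<in> rays V E" "disjoint_family_on (\<lambda>s. range (r s)) S0"
    by (elim exE conjE)
  moreover have "finite S0" using assms(1) by (simp add: minimal_def tight_def)
  ultimately show ?thesis using assms(2) by (intro disjoint_rays_family[of S0 r]) simp_all
qed

section \<open>Layers of enclosures, and shrinking a separator\<close>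

text \<open>
  As \<open>T \<union> far T\<close> is connected, so is \<open>T\<close> within the part of it that a suitable \<open>T'\<close> encloses.
\<close>

lemma next_layer:
  assumes T: "tight T"
  shows "\<exists>T'. tight T' \<and> T \<subseteq> near T' \<and> (\<forall>x\<in>T. \<forall>y\<in>T. (x, y) \<in> connected_in (near T' - near T) E)"
proof -
  have fin: "finite T" "T \<subseteq> V" using T by (auto simp: tight_def)
  obtain P where P: "finite P" "P \<subseteq> T \<union> far T" "connected_set E P" "T \<subseteq> P"
    using finite_connected_superset[OF sym fin(1), of "T \<union> far T"] tight_Un_far_connected[OF T]
    by blast
  have "P \<subseteq> V" using P(2) fin(2) far_subset[of T] by blast
  then obtain T' where T': "tight T'" "P \<subseteq> near T'"
    using finite_set_enclosed P(1) by blast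
  have "P \<subseteq> near T' - near T" using P(2) T'(2) far_near_disjoint[of T] by blast
  then have "(x, y) \<in> connected_in (near T' - near T) E" if "x \<in> T" "y \<in> T" for x y
    using that P(4) by (intro connected_set_subset_in[OF P(3)]) blast+
  then show ?thesis using T' P(4) by blast
qed

text \<open>
  A chosen next enclosure around \<open>T\<close>.
\<close>

definition enlarge :: "'a set \<Rightarrow> 'a set" where
  "enlarge T = (SOME T'. tight T' \<and> T \<subseteq> near T' \<and>
     (\<forall>x\<in>T. \<forall>y\<in>T. (x, y) \<in> connected_in (near T' - near T) E))"

lemma enlarge:
  assumes "tight T"
  shows "tight (enlarge T)" "T \<subseteq> near (enlarge T)"
    "\<And>x y. x \<in> T \<Longrightarrow> y \<in> T \<Longrightarrow> (x, y) \<in> connected_in (near (enlarge T) - near T) E"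
  using someI_ex[OF next_layer[OF assms]] unfolding enlarge_def by blast+

text \<open>
  A sequence of enclosures of \<open>v\<close>, each one enclosing the previous one.
\<close>

definition layer :: "'a \<Rightarrow> nat \<Rightarrow> 'a set" where
  "layer v i = (enlarge ^^ i) (SOME T. tight T \<and> v \<in> near T)"

lemma layer_tight:
  assumes "v \<in> V"
  shows "tight (layer v i)"
proof (induction i)
  case 0
  have "\<exists>T. tight T \<and> v \<in> near T" using finite_set_enclosed[of "{v}"] assms by auto
  from someI_ex[OF this] show ?case by (simp add: layer_def)
next
  case (Suc i)
  then show ?case using enlarge(1) by (simp add: layer_def)
qed

lemma layer_near_mono:
  assumes "v \<in> V" "i \<le> j"
  shows "near (layer v i) \<subseteq> near (layer v j)"
  using assms(2)
proof (induction rule: dec_induct)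
  case (step j)
  have t: "tight (layer v j)" "layer v (Suc j) = enlarge (layer v j)"
    using layer_tight[OF assms(1)] by (auto simp: layer_def)
  have "near (layer v j) \<subseteq> near (enlarge (layer v j))"
    using t(1) enlarge[OF t(1)] far_near_disjoint[of "enlarge (layer v j)"]
    by (intro near_mono) (auto simp: tight_def)
  then show ?case using step t(2) by simp
qed simp

lemma mem_near_layer:
  assumes "v \<in> V"
  shows "v \<in> near (layer v i)"
proof -
  have "\<exists>T. tight T \<and> v \<in> near T" using finite_set_enclosed[of "{v}"] assms by auto
  from someI_ex[OF this] have "v \<in> near (layer v 0)" by (simp add: layer_def)
  then show ?thesis using layer_near_mono[OF assms, of 0 i] by blast
qed

text \<open>
  If a set \<open>T\<close> lies on one side of \<open>S\<close>, then the vertices of \<open>S\<close> enclosed by \<open>T\<close> can be dropped: a path to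
  the end that leaves \<open>near S\<close> through one of them has still to cross \<open>T\<close>, and re-enters \<open>near S\<close> there if
  \<open>T \<subseteq> near S\<close>; if \<open>T \<subseteq> far S\<close>, it started in \<open>near T\<close>.
\<close>

lemma near_subset_remove_if_near:
  assumes "finite S" "finite T" "T \<subseteq> near S"
  shows "near S \<subseteq> near (S - near T)"
proof -
  let ?S = "S - near T"
  have "far ?S \<subseteq> far S \<inter> far T"
  proof -
    obtain x where x: "x \<in> far (S \<union> T)" using common_far[of "S \<union> T" "S \<union> T"] assms by blast
    have "x \<in> far ?S" "x \<in> far S \<inter> far T"
      using x far_antimono[of ?S "S \<union> T"] far_antimono[of S "S \<union> T"] far_antimono[of T "S \<union> T"] by blast+
    then show ?thesis
    proof (rule far_subset_closed)
      fix k u assume k: "k \<in> far S \<inter> far T" "u \<in> far ?S" "E k u"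
      have u: "u \<in> V" "u \<notin> ?S" using k(2) far_subset[of ?S] by auto
      have "u \<notin> near T" "u \<notin> near S"
        using k near_far_no_edge[of u T k] near_far_no_edge[of u S k] E_sym by blast+
      then have "u \<notin> S" "u \<notin> T" using u assms(3) by auto
      then show "u \<in> far S \<inter> far T" using k u far_edge by blast
    qed
  qed
  then show ?thesis by (auto simp: near_def)
qed

lemma near_subset_remove_if_far:
  assumes "finite S" "T \<subseteq> far S"
  shows "near S - near T \<subseteq> near (S - near T)"
proof -
  let ?S = "S - near T"
  have "far ?S \<subseteq> far S \<union> near T"
  proof -
    obtain x where x: "x \<in> far S" "x \<in> far ?S" using common_far[of S ?S] assms(1) by blast
    then have "x \<in> far S \<union> near T" by blast
    with x(2) show ?thesis
    proof (rule far_subset_closed)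
      fix k u assume k: "k \<in> far S \<union> near T" "u \<in> far ?S" "E k u"
      have u: "u \<in> V" "u \<notin> ?S" using k(2) far_subset[of ?S] by auto
      from k(1) show "u \<in> far S \<union> near T"
      proof
        assume "k \<in> far S"
        then show ?thesis using far_edge[of k S u] k(3) u by blast
      next
        assume "k \<in> near T"
        then show ?thesis using near_edge[of k T u] k(3) u assms(2) by blast
      qed
    qed
  qed
  then show ?thesis by (auto simp: near_def)
qed

end

section \<open>Quasi-transitivity\<close>

lemma automorphism_comp:
  assumes "graph_automorphism V E f" "graph_automorphism V E g"
  shows "graph_automorphism V E (f \<circ> g)"
  using assms bij_betw_trans[of g V V f V] by (auto simp: graph_automorphism_def dest: bij_betwE)

lemma automorphism_funpow:
  assumes "graph_automorphism V E f"
  shows "graph_automorphism V E (f ^^ n)"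
proof (induction n)
  case 0
  have "bij_betw (\<lambda>x. x) V V" by (simp add: bij_betw_def)
  then show ?case by (simp add: graph_automorphism_def id_def)
next
  case (Suc n)
  from automorphism_comp[OF assms this] show ?case by (simp only: funpow.simps)
qed

lemma automorphism_mem: "graph_automorphism V E f \<Longrightarrow> x \<in> V \<Longrightarrow> f x \<in> V"
  by (auto simp: graph_automorphism_def dest: bij_betwE)

lemma automorphism_inj: "graph_automorphism V E f \<Longrightarrow> inj_on f V"
  by (auto simp: graph_automorphism_def bij_betw_def)

context undominated
begin

text \<open>
  An automorphism that pushes \<open>T\<close> towards the inside of what \<open>T\<close> encloses moves a path from \<open>t \<in> T\<close>
  to \<open>f t\<close> deeper and deeper inside, and the images contain a ray that does not belong to the end.
\<close>

lemma no_contracting_automorphism: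
  assumes f: "graph_automorphism V E f" and T: "tight T" "T \<noteq> {}"
    and contract: "f ` (T \<union> near T) \<subseteq> near T"
  shows False
proof -
  have fin: "finite T" "T \<subseteq> V" using T by (auto simp: tight_def)
  have near_V: "near T \<subseteq> V" by (auto simp: near_def)
  obtain t where t: "t \<in> T" using T(2) by blast
  have fT: "tight (f ` T)" "near (f ` T) = f ` near T"
    using automorphism_tight[OF f T(1)] automorphism_near[OF f fin] by auto
  have "t \<notin> near (f ` T)"
    using contract t far_near_disjoint[of T] unfolding fT(2) by blast
  then have "t \<in> f ` T \<union> far (f ` T)" using side_cases[of t "f ` T"] t fin(2) by blast
  from tight_Un_far_connected[OF fT(1) this, of "f t"] t
  have "(t, f t) \<in> connected_in (f ` T \<union> far (f ` T)) E" by blast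
  from connected_in_finite_connected_set[OF sym this]
  obtain P where P: "finite P" "P \<subseteq> f ` T \<union> far (f ` T)" "connected_set E P" "t \<in> P" "f t \<in> P"
    by blast
  have P_V: "P \<subseteq> V" using P(2) far_subset[of "f ` T"] fT(1) by (auto simp: tight_def)
  have P_near: "P \<inter> f ` near T = {}"
    using P(2) far_near_disjoint[of "f ` T"] unfolding fT(2) by blast
  have inward: "(f ^^ m) v \<in> near T" if "(f ^^ n) v \<in> near T" "n \<le> m" for m n v
    using that(2)
  proof (induction rule: dec_induct)
    case base
    show ?case by (rule that(1))
  next
    case (step m)
    then show ?case using contract by auto
  qed
  \<comment> \<open>The set of these \<open>v\<close> is closed under adjacency, since \<open>f\<close> maps \<open>T \<union> near T\<close> into \<open>near T\<close>.\<close>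
  have "\<exists>c. (f ^^ c) v \<in> near T" if v: "v \<in> V" for v
  proof -
    have ft: "f t \<in> near T" "f t \<in> V" using contract t automorphism_mem[OF f] fin(2) by auto
    have "(f t, v) \<in> connected_in V E" using connected ft(2) v by (intro connected_setD)
    moreover have "f t \<in> {v. \<exists>c. (f ^^ c) v \<in> near T}" using ft(1) by (auto intro: exI[of _ 0])
    ultimately have "v \<in> {v. \<exists>c. (f ^^ c) v \<in> near T}"
    proof (rule connected_in_closed)
      fix k u assume k: "k \<in> {v. \<exists>c. (f ^^ c) v \<in> near T}" "k \<in> V" "u \<in> V" "E k u"
      then obtain c where c: "(f ^^ c) k \<in> near T" by blast
      have fc: "graph_automorphism V E (f ^^ c)" by (rule automorphism_funpow[OF f])
      have "E ((f ^^ c) k) ((f ^^ c) u)" using fc k by (simp add: graph_automorphism_def)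
      then have "(f ^^ c) u \<in> T \<union> near T"
        using near_edge[OF c] automorphism_mem[OF fc k(3)] by blast
      then have "(f ^^ Suc c) u \<in> near T" using contract by auto
      then show "u \<in> {v. \<exists>c. (f ^^ c) v \<in> near T}" by blast
    qed
    then show ?thesis by blast
  qed
  then obtain c where c: "\<And>v. v \<in> P \<Longrightarrow> (f ^^ c v) v \<in> near T" using P_V by (metis subsetD)
  define N where "N = sum c P"
  have N: "(f ^^ N) v \<in> near T" if "v \<in> P" for v
    using c[OF that] member_le_sum[of v P c] that P(1) by (intro inward[of "c v" v N]) (auto simp: N_def)
  \<comment> \<open>\<open>W j\<close> and \<open>W m\<close> are disjoint if \<open>j > m + N\<close>: otherwise a power of \<open>f\<close> maps a vertex of \<open>P\<close> into
      \<open>P \<inter> f ` near T\<close>, which is empty.\<close>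
  define W where "W j = (f ^^ (N + j)) ` P" for j
  have W_near: "W j \<subseteq> near T" for j
    using N inward[of N _ "N + j"] by (auto simp: W_def)
  have "\<exists>R \<in> rays V E. range R \<subseteq> (\<Union>j. W j)"
  proof (rule ray_from_unbounded_chain[OF sym])
    show "W j \<subseteq> V" for j using W_near near_V by blast
    show "connected_set E (W j)" for j
      unfolding W_def by (rule automorphism_connected_set[OF automorphism_funpow[OF f] P_V P(3)])
    show "W j \<inter> W (Suc j) \<noteq> {}" for j
    proof -
      have "(f ^^ (N + Suc j)) t = (f ^^ (N + j)) (f t)" by (simp add: funpow_swap1)
      then have "(f ^^ (N + Suc j)) t \<in> W j" unfolding W_def using P(5) by (metis imageI)
      moreover have "(f ^^ (N + Suc j)) t \<in> W (Suc j)" unfolding W_def using P(4) by (rule imageI)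
      ultimately show ?thesis by blast
    qed
    show "finite {j. v \<in> W j}" for v
    proof (cases "\<exists>m. v \<in> W m")
      case True
      then obtain m where m: "v \<in> W m" by blast
      have "j \<le> m + N" if j: "v \<in> W j" for j
      proof (rule ccontr)
        assume "\<not> j \<le> m + N"
        then obtain d where d: "j = m + Suc (N + d)" by (metis add_Suc_right less_iff_Suc_add not_le add.assoc)
        obtain p q where pq: "p \<in> P" "q \<in> P" "v = (f ^^ (N + m)) p" "v = (f ^^ (N + j)) q"
          using m j by (auto simp: W_def)
        have "(f ^^ (N + j)) q = (f ^^ (N + m)) ((f ^^ Suc (N + d)) q)"
          by (simp only: d add.assoc[symmetric] funpow_add o_apply)
        then have "p = (f ^^ Suc (N + d)) q"
          using pq P_V automorphism_inj[OF automorphism_funpow[OF f]]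
            automorphism_mem[OF automorphism_funpow[OF f], of q "Suc (N + d)"]
          by (metis inj_onD subsetD)
        moreover have "(f ^^ (N + d)) q \<in> near T" using N[OF pq(2)] by (rule inward) simp
        ultimately have "p \<in> f ` near T" by simp
        then show False using pq(1) P_near by blast
      qed
      then show ?thesis by (auto intro: finite_subset[of _ "{..m + N}"])
    qed auto
  qed
  then obtain R where R: "R \<in> rays V E" "range R \<subseteq> (\<Union>j. W j)" by (elim bexE)
  have "(\<Union>j. W j) \<subseteq> near T" by (rule UN_least) (rule W_near)
  with R(2) have R_near: "range R \<subseteq> near T" by (rule order_trans)
  obtain n where "R n \<in> far T" using ray_tail_in_far[OF R(1) fin(1)] by blast
  then show False using R_near far_near_disjoint[of T] by blast
qed

lemma not_all_enclosed_by_translates: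
  assumes T: "tight T"
    and all: "\<And>X. finite X \<Longrightarrow> X \<subseteq> V \<Longrightarrow> \<exists>f. graph_automorphism V E f \<and> X \<subseteq> near (f ` T)"
  shows False
proof -
  have fin: "finite T" "T \<subseteq> V" using T by (auto simp: tight_def)
  have R0: "R0 0 \<in> V" using ray by (auto simp: rays_def)
  have "T \<noteq> {}"
  proof
    assume "T = {}"
    moreover obtain f where "R0 0 \<in> near (f ` T)" using all[of "{R0 0}"] R0 by auto
    ultimately show False by (simp add: near_empty)
  qed
  obtain g where g: "graph_automorphism V E g" "T \<subseteq> near (g ` T)" using all[OF fin] by blast
  have near_g: "near (g ` T) = g ` near T" by (rule automorphism_near[OF g(1) fin])
  have "near T \<subseteq> near (g ` T)"
    using near_mono(2)[OF fin(1) automorphism_tight[OF g(1) T]] g(2) far_near_disjoint[of "g ` T"] by blast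
  then have "inv_into V g ` (T \<union> near T) \<subseteq> inv_into V g ` g ` near T"
    using g(2) near_g by blast
  also have "\<dots> = near T"
    by (rule inv_into_image_cancel[OF automorphism_inj[OF g(1)]]) (auto simp: near_def)
  finally show False
    using no_contracting_automorphism[OF automorphism_inv[OF g(1)] T \<open>T \<noteq> {}\<close>] by blast
qed

text \<open>
  One vertex of \<open>S\<close> is the centre \<open>f v\<close> of the \<open>k\<close> disjoint regions, so at most \<open>k - 1\<close> of the
  regions meet \<open>S\<close>.
\<close>

lemma layer_interval_avoids:
  assumes v: "v \<in> V" and f: "graph_automorphism V E f" and S: "finite S" "card S \<le> k" "f v \<in> S"
  shows "\<exists>i<k. (near (f ` layer v (Suc i)) - near (f ` layer v i)) \<inter> S = {}"
proof (rule ccontr)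
  assume no: "\<not> ?thesis"
  let ?N = "\<lambda>i. near (f ` layer v i)"
  have lay: "finite (layer v i)" "layer v i \<subseteq> V" for i
    using layer_tight[OF v, of i] by (auto simp: tight_def)
  have N: "?N i = f ` near (layer v i)" for i by (rule automorphism_near[OF f lay])
  have mono: "?N i \<subseteq> ?N j" if "i \<le> j" for i j
    using layer_near_mono[OF v that] unfolding N by (rule image_mono)
  define s where "s i = (SOME x. x \<in> (?N (Suc i) - ?N i) \<inter> S)" for i
  have s: "s i \<in> S \<and> s i \<in> ?N (Suc i) \<and> s i \<notin> ?N i" if i: "i < k" for i
  proof -
    have "(?N (Suc i) - ?N i) \<inter> S \<noteq> {}" using no i by blast
    from some_in_eq[THEN iffD2, OF this] show ?thesis unfolding s_def by blast
  qed
  have "inj_on s {..<k}"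
  proof (rule linorder_inj_onI)
    fix i j assume ij: "i < j" "i \<in> {..<k}" "j \<in> {..<k}"
    then have "s i \<in> ?N j" using s[of i] mono[of "Suc i" j] by auto
    then show "s i \<noteq> s j" using s[of j] ij by auto
  qed auto
  moreover have "s ` {..<k} \<subseteq> S - {f v}"
  proof (rule image_subsetI)
    fix i assume "i \<in> {..<k}"
    moreover have "f v \<in> ?N i" unfolding N using mem_near_layer[OF v] by (rule imageI)
    ultimately show "s i \<in> S - {f v}" using s[of i] by auto
  qed
  ultimately have "k \<le> card (S - {f v})"
    using card_inj_on_le[of s "{..<k}" "S - {f v}"] S(1) by simp
  moreover have "card (S - {f v}) < card S" using S by (intro psubset_card_mono) auto
  ultimately show False using S(2) by simp
qed

text \<open>
  The vertices of a translated layer lie on one side of a set \<open>S\<close> that avoids the interval between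
  this layer and the next one.
\<close>

lemma layer_one_side:
  assumes v: "v \<in> V" and f: "graph_automorphism V E f"
    and avoid: "(near (f ` layer v (Suc i)) - near (f ` layer v i)) \<inter> S = {}"
  shows "f ` layer v i \<subseteq> near S \<or> f ` layer v i \<subseteq> far S"
proof -
  let ?L = "near (layer v (Suc i)) - near (layer v i)"
  have lay: "finite (layer v i)" "layer v i \<subseteq> V" for i
    using layer_tight[OF v, of i] by (auto simp: tight_def)
  have L_V: "?L \<subseteq> V" by (auto simp: near_def)
  have "f ` ?L = f ` near (layer v (Suc i)) - f ` near (layer v i)"
    by (rule inj_on_image_set_diff[OF automorphism_inj[OF f]]) (auto simp: near_def)
  then have fL: "f ` ?L = near (f ` layer v (Suc i)) - near (f ` layer v i)"
    by (simp add: automorphism_near[OF f lay])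
  have L: "(x, y) \<in> connected_in ?L E" if "x \<in> layer v i" "y \<in> layer v i" for x y
    using enlarge(3)[OF layer_tight[OF v] that] by (simp add: layer_def)
  have conn: "(x, y) \<in> connected_in (V - S) E" if xy: "x \<in> f ` layer v i" "y \<in> f ` layer v i" for x y
  proof -
    obtain a b where ab: "a \<in> layer v i" "b \<in> layer v i" "x = f a" "y = f b" using xy by blast
    have "(x, y) \<in> connected_in (f ` ?L) E"
      unfolding ab(3,4) by (rule automorphism_connected_in[OF f L_V L[OF ab(1,2)]])
    moreover have "f ` ?L \<subseteq> V - S" using fL avoid by (auto simp: near_def)
    ultimately show ?thesis by (rule connected_in_mono)
  qed
  show ?thesis
  proof (cases "\<exists>x\<in>f ` layer v i. x \<in> far S")
    case True
    then obtain x where x: "x \<in> f ` layer v i" "x \<in> far S" by blast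
    have "y \<in> far S" if "y \<in> f ` layer v i" for y
      using conn[OF x(1) that] x(2) by (rule connected_in_closed) (use far_edge in blast)
    then show ?thesis by blast
  next
    case False
    have "y \<in> near S" if y: "y \<in> f ` layer v i" for y
      using conn[OF y y] False y by (auto simp: near_def dest: connected_in_memD)
    then show ?thesis by blast
  qed
qed

lemma bounded_enclosure:
  assumes no: "\<nexists>F. disjoint_rays_in (rays V E) F \<and> finite F \<and> card F = n"
    and X: "finite X" "X \<subseteq> V"
  shows "\<exists>S. finite S \<and> S \<subseteq> V \<and> card S \<le> n \<and> X \<subseteq> near S"
proof -
  obtain S where S: "minimal S" "X \<subseteq> near S" using finite_set_enclosed_minimal[OF X] by blast
  then have "card S < n" using disjoint_rays_if_large_minimal[OF S(1), of n] no by (meson not_le)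
  then show ?thesis using S by (intro exI[of _ S]) (auto simp: minimal_def tight_def)
qed

text \<open>
  \<open>B\<close> meets every orbit. Note that the set \<open>S\<close> below is enclosing a connected set \<open>Y\<close>, which is
  why \<open>Y\<close> is enclosed entirely by a set \<open>?T \<subseteq> far S\<close> as soon as one of its vertices is.
\<close>

lemma many_disjoint_rays:
  assumes reps: "finite B" "B \<subseteq> V" "\<And>v. v \<in> V \<Longrightarrow> \<exists>b\<in>B. \<exists>f. graph_automorphism V E f \<and> f b = v"
  shows "\<exists>F. disjoint_rays_in (rays V E) F \<and> finite F \<and> card F = n"
proof (rule ccontr)
  assume no: "\<not> ?thesis"
  define bound where "bound k \<longleftrightarrow>
    (\<forall>X. finite X \<longrightarrow> X \<subseteq> V \<longrightarrow> (\<exists>S. finite S \<and> S \<subseteq> V \<and> card S \<le> k \<and> X \<subseteq> near S))" for k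
  have "bound n" unfolding bound_def using bounded_enclosure[OF no] by blast
  define k where "k = (LEAST k. bound k)"
  have k: "bound k" unfolding k_def using \<open>bound n\<close> by (rule LeastI)
  have "\<exists>X0. finite X0 \<and> X0 \<subseteq> V \<and> (\<forall>S. finite S \<longrightarrow> S \<subseteq> V \<longrightarrow> X0 \<subseteq> near S \<longrightarrow> k \<le> card S)"
  proof (cases k)
    case 0
    then show ?thesis by (intro exI[of _ "{}"]) simp
  next
    case (Suc j)
    then have "\<not> bound j" using not_less_Least[of j bound] by (simp add: k_def)
    then obtain X0 where X0: "finite X0" "X0 \<subseteq> V" "\<not> (\<exists>S. finite S \<and> S \<subseteq> V \<and> card S \<le> j \<and> X0 \<subseteq> near S)"
      unfolding bound_def by (auto simp only: not_all not_imp)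
    then have "k \<le> card S" if "finite S" "S \<subseteq> V" "X0 \<subseteq> near S" for S
      using that Suc by (meson not_less_eq_eq)
    then show ?thesis using X0(1,2) by blast
  qed
  then obtain X0 where X0: "finite X0" "X0 \<subseteq> V"
      "\<And>S. finite S \<Longrightarrow> S \<subseteq> V \<Longrightarrow> X0 \<subseteq> near S \<Longrightarrow> k \<le> card S" by (elim exE conjE) simp
  have R0: "R0 0 \<in> V" using ray by (auto simp: rays_def)
  have enclosed: "\<exists>b\<in>B. \<exists>i<k. \<exists>f. graph_automorphism V E f \<and> X \<subseteq> near (f ` layer b i)"
    if X: "finite X" "X \<subseteq> V" for X
  proof -
    have "\<exists>Y. finite Y \<and> Y \<subseteq> V \<and> connected_set E Y \<and> X \<union> X0 \<union> {R0 0} \<subseteq> Y"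
      using X X0 R0 connected by (intro finite_connected_superset[OF sym]) (auto intro: connected_setD)
    then obtain Y where Y: "finite Y" "Y \<subseteq> V" "connected_set E Y" "X \<subseteq> Y" "X0 \<subseteq> Y" "R0 0 \<in> Y" by auto
    obtain S where S: "finite S" "S \<subseteq> V" "card S \<le> k" "Y \<subseteq> near S"
      using k Y(1,2) unfolding bound_def by meson
    have "S \<noteq> {}" using S(4) Y(6) near_empty by blast
    then obtain w where w: "w \<in> S" "w \<in> V" using S(2) by blast
    obtain b f where bf: "b \<in> B" "graph_automorphism V E f" "f b = w" using reps(3)[OF w(2)] by blast
    have b: "b \<in> V" using bf(1) reps(2) by blast
    obtain i where i: "i < k" "(near (f ` layer b (Suc i)) - near (f ` layer b i)) \<inter> S = {}"
      using layer_interval_avoids[OF b bf(2) S(1,3)] bf(3) w(1) by blast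
    let ?T = "f ` layer b i"
    have "tight (layer b i)" by (rule layer_tight[OF b])
    then have T: "finite ?T" "finite (layer b i)" "layer b i \<subseteq> V" by (auto simp: tight_def)
    have "w \<in> near ?T"
      using mem_near_layer[OF b, of i] bf(3) automorphism_near[OF bf(2) T(2,3)] by blast
    then have "card (S - near ?T) < card S"
      using w(1) S(1) by (intro psubset_card_mono) auto
    then have not_enclosed: "\<not> X0 \<subseteq> near (S - near ?T)"
      using X0(3)[of "S - near ?T"] S(1-3) by auto
    consider "?T \<subseteq> near S" | "?T \<subseteq> far S" using layer_one_side[OF b bf(2) i(2)] by blast
    then have "Y \<subseteq> near ?T"
    proof cases
      case 1
      then show ?thesis
        using near_subset_remove_if_near[OF S(1) T(1)] not_enclosed S(4) Y(5) by blast
    next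
      case 2
      have "\<not> Y \<inter> near ?T = {}"
        using near_subset_remove_if_far[OF S(1) 2] not_enclosed S(4) Y(5) by blast
      then obtain y where y: "y \<in> Y" "y \<in> near ?T" by blast
      have Y_T: "Y \<inter> ?T = {}" using 2 S(4) far_near_disjoint[of S] by blast
      have "z \<in> near ?T" if z: "z \<in> Y" for z
        using connected_setD[OF Y(3) y(1) z] y(2)
      proof (rule connected_in_closed)
        fix k u assume "k \<in> near ?T" "u \<in> Y" "E k u"
        then show "u \<in> near ?T" using near_edge[of k ?T u] Y_T Y(2) by blast
      qed
      then show ?thesis by blast
    qed
    then show ?thesis using Y(4) bf i(1) by blast
  qed
  let ?I = "B \<times> {..<k}"
  have "\<exists>(b, i)\<in>?I. \<forall>X. finite X \<longrightarrow> X \<subseteq> V \<longrightarrow> (\<exists>f. graph_automorphism V E f \<and> X \<subseteq> near (f ` layer b i))"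
  proof (rule ccontr)
    assume "\<not> ?thesis"
    then have "\<forall>z\<in>?I. \<exists>X. finite X \<and> X \<subseteq> V \<and>
        \<not> (\<exists>f. graph_automorphism V E f \<and> X \<subseteq> near (f ` layer (fst z) (snd z)))" by auto
    then obtain X where X: "\<And>z. z \<in> ?I \<Longrightarrow> finite (X z) \<and> X z \<subseteq> V \<and>
        \<not> (\<exists>f. graph_automorphism V E f \<and> X z \<subseteq> near (f ` layer (fst z) (snd z)))" by metis
    have "finite (\<Union>z\<in>?I. X z)" "(\<Union>z\<in>?I. X z) \<subseteq> V" using X reps(1) by blast+
    from enclosed[OF this] obtain b i f where "b \<in> B" "i < k" "graph_automorphism V E f"
        "(\<Union>z\<in>?I. X z) \<subseteq> near (f ` layer b i)" by blast
    moreover from this have "X (b, i) \<subseteq> near (f ` layer b i)" by blast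
    ultimately show False using X[of "(b, i)"] by auto
  qed
  then obtain b i where bi: "b \<in> B" "\<And>X. finite X \<Longrightarrow> X \<subseteq> V \<Longrightarrow>
      \<exists>f. graph_automorphism V E f \<and> X \<subseteq> near (f ` layer b i)" by blast
  show False
    using not_all_enclosed_by_translates[OF layer_tight bi(2)] bi(1) reps(2) by blast
qed

end

section \<open>Removing finitely many dominating vertices\<close>

context one_end
begin

lemma automorphism_dominating:
  assumes f: "graph_automorphism V E f" and v: "dominating v"
  shows "dominating (f v)"
  unfolding dominating_def
proof (intro conjI allI impI)
  have vV: "v \<in> V" using v by (simp add: dominating_def)
  then show "f v \<in> V" by (rule automorphism_mem[OF f])
  fix S assume S: "finite S" "f v \<notin> S"
  let ?T = "inv_into V f ` (S \<inter> V)"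
  have bij: "bij_betw f V V" using f by (simp add: graph_automorphism_def)
  have T: "finite ?T" "?T \<subseteq> V"
    using S(1) bij_betwE[OF bij_betw_inv_into[OF bij]] by auto
  have fT: "f ` ?T = S \<inter> V"
    using bij by (intro image_inv_into_cancel[of f V V]) (auto simp: bij_betw_def)
  then have "v \<notin> ?T" using S(2) by blast
  then have "v \<in> far ?T" using dominatingD[OF v T(1)] by blast
  then have "f v \<in> far (S \<inter> V)" using automorphism_far[OF f T] fT by auto
  moreover have "V - S \<inter> V = V - S" by auto
  ultimately show "f v \<in> far S" by (simp add: far_def)
qed

lemma disjoint_rays_if_finitely_many_dominating:
  assumes fin: "finite {v. dominating v}" and quasi: "quasi_transitive V E"
  shows "\<exists>F. disjoint_rays_in (rays V E) F \<and> finite F \<and> card F = n"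
proof -
  let ?D = "{v. dominating v}" and ?V = "far {v. dominating v}"
  have D_V: "?D \<subseteq> V" by (auto simp: dominating_def)
  obtain N where N: "\<And>i. i \<ge> N \<Longrightarrow> R0 i \<in> ?V" using ray_tail_in_far[OF ray fin] by blast
  define R where "R i = R0 (i + N)" for i
  have R_ray: "R \<in> rays ?V E"
  proof (rule rayI)
    show "range R \<subseteq> ?V" using N by (auto simp: R_def)
    have "inj R0" using ray by (simp add: rays_def)
    then show "inj R" unfolding R_def by (intro injI) (auto dest: injD)
    show "E (R n) (R (Suc n))" for n using ray by (simp add: rays_def R_def)
  qed
  have sub: "rays ?V E \<subseteq> rays V E" using far_subset[of ?D] by (auto simp: rays_def)
  interpret W: one_end ?V E R
  proof
    show "symp E" by (rule sym)
    show "\<not> E u u" for u by (rule irrefl)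
    show "R \<in> rays ?V E" by (rule R_ray)
    fix Q S assume Q: "Q \<in> rays ?V E" and S: "finite (S :: 'a set)"
    obtain m where m: "\<And>i j. i \<ge> m \<Longrightarrow> j \<ge> m \<Longrightarrow> (Q i, R0 j) \<in> connected_in (V - (S \<union> ?D)) E"
      using equiv[of Q "S \<union> ?D"] Q sub S fin by blast
    have "(Q i, R j) \<in> connected_in (?V - S) E" if ij: "i \<ge> m" "j \<ge> m" for i j
    proof -
      let ?K = "{u. (Q i, u) \<in> connected_in (V - (S \<union> ?D)) E}"
      have QV: "Q i \<in> ?V" using Q by (auto simp: rays_def)
      have K: "?K \<subseteq> ?V - S"
      proof
        fix u assume u: "u \<in> ?K"
        then have "(Q i, u) \<in> connected_in (V - (S \<union> ?D)) E" by simp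
        then have "u \<in> ?V" using QV by (rule connected_in_closed) (use far_edge in blast)
        then show "u \<in> ?V - S" using u by (auto dest: connected_in_memD)
      qed
      have "(Q i, R j) \<in> connected_in ?K E"
        unfolding R_def using m[OF ij(1), of "j + N"] ij(2) by (intro connected_in_reachable) simp
      then show ?thesis using K by (rule connected_in_mono)
    qed
    then show "\<exists>n. \<forall>i\<ge>n. \<forall>j\<ge>n. (Q i, R j) \<in> connected_in (?V - S) E" by blast
  qed
  interpret W: undominated ?V E R
  proof
    show "connected_set E ?V" by (rule far_connected)
    fix v assume v: "v \<in> ?V"
    then have "v \<in> V" "\<not> dominating v" using far_subset[of ?D] by auto
    then obtain S where S: "finite S" "v \<notin> S" "v \<notin> far S" by (auto simp: dominating_def)
    have "v \<notin> W.far (S \<inter> ?V)"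
    proof
      assume "v \<in> W.far (S \<inter> ?V)"
      then obtain m where m: "\<And>j. j \<ge> m \<Longrightarrow> (v, R j) \<in> connected_in (?V - S \<inter> ?V) E"
        by (auto simp: W.far_def)
      have "(v, R0 j) \<in> connected_in (V - S) E" if "j \<ge> m + N" for j
      proof -
        have "(v, R (j - N)) \<in> connected_in (V - S) E"
          using that far_subset[of ?D] by (intro connected_in_mono[OF m]) auto
        then show ?thesis using that by (simp add: R_def)
      qed
      then show False using S(3) by (auto simp: far_def)
    qed
    then have "v \<in> W.near (S \<inter> ?V)" using v S(2) by (auto simp: W.near_def)
    then show "\<exists>S. finite S \<and> S \<subseteq> ?V \<and> v \<in> W.near S"
      using S(1) by (intro exI[of _ "S \<inter> ?V"]) auto
  qed
  have restrict: "graph_automorphism ?V E f" if f: "graph_automorphism V E f" for f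
  proof -
    have "f ` ?D \<subseteq> ?D" using automorphism_dominating[OF f] by blast
    then have "f ` ?D = ?D"
      using inj_on_subset[OF automorphism_inj[OF f] D_V] fin by (intro endo_inj_surj)
    then have "f ` ?V = ?V" using automorphism_far[OF f fin D_V] by simp
    then show ?thesis
      using f inj_on_subset[OF automorphism_inj[OF f], of ?V] far_subset[of ?D]
      by (auto simp: graph_automorphism_def bij_betw_def subset_iff)
  qed
  have "finite (vertex_orbit V E ` ?V)"
    using quasi far_subset[of ?D] unfolding quasi_transitive_def
    by (elim finite_subset[rotated]) blast
  then obtain B where B: "B \<subseteq> ?V" "finite B" "vertex_orbit V E ` ?V = vertex_orbit V E ` B"
    using finite_subset_image[of "vertex_orbit V E ` ?V" "vertex_orbit V E" ?V] by blast
  have "\<exists>b\<in>B. \<exists>f. graph_automorphism ?V E f \<and> f b = v" if v: "v \<in> ?V" for v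
  proof -
    have "vertex_orbit V E v \<in> vertex_orbit V E ` B" using v unfolding B(3)[symmetric] by blast
    then obtain b where b: "b \<in> B" "vertex_orbit V E v = vertex_orbit V E b" by blast
    have "bij_betw (\<lambda>x. x) V V" by (simp add: bij_betw_def)
    then have "graph_automorphism V E (\<lambda>x. x)" by (simp add: graph_automorphism_def)
    then have "v \<in> vertex_orbit V E v"
      unfolding vertex_orbit_def by (intro CollectI exI[of _ "\<lambda>x. x"]) simp
    then obtain f where "v = f b" "graph_automorphism V E f"
      unfolding b(2) by (auto simp: vertex_orbit_def)
    then show ?thesis using b(1) restrict by blast
  qed
  from W.many_disjoint_rays[OF B(2,1) this]
  obtain F where "disjoint_rays_in (rays ?V E) F" "finite F" "card F = n" by blast
  then show ?thesis using sub by (intro exI[of _ F]) (auto simp: disjoint_rays_in_def)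
qed

end

section \<open>One-ended quasi-transitive graphs\<close>

lemma one_ended_end_eq_rays:
  assumes "simple_graph V E" "one_ended V E" "\<omega> \<in> ends V E"
  shows "\<omega> = rays V E" "\<And>R Q. R \<in> rays V E \<Longrightarrow> Q \<in> rays V E \<Longrightarrow> (R, Q) \<in> end_equiv V E"
proof -
  have eq: "equiv (rays V E) (end_equiv V E)" by (rule equiv_end_equiv[OF assms(1)])
  have cls: "end_equiv V E `` {R} = \<omega>" if "R \<in> rays V E" for R
    using quotientI[OF that, of "end_equiv V E"] assms(2,3) unfolding one_ended_def ends_def by blast
  have "R \<in> \<omega>" if "R \<in> rays V E" for R
    using equiv_class_self[OF eq that] cls[OF that] by simp
  moreover have "\<omega> \<subseteq> rays V E"
    using in_quotient_imp_subset[OF eq] assms(3) unfolding ends_def by blast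
  ultimately show \<omega>: "\<omega> = rays V E" by blast
  show "(R, Q) \<in> end_equiv V E" if "R \<in> rays V E" "Q \<in> rays V E" for R Q
    using cls[OF that(1)] that(2) \<omega> by blast
qed

lemma equivalent_rays_eventually_connected:
  assumes "simple_graph V E" "(R, Q) \<in> end_equiv V E" "finite S"
  shows "\<exists>n. \<forall>i\<ge>n. \<forall>j\<ge>n. (R i, Q j) \<in> connected_in (V - S) E"
proof -
  have "finite (S \<inter> V)" "S \<inter> V \<subseteq> V" using assms(3) by auto
  from end_equivD(3)[OF assms(2) this] obtain C m n where
    C: "C \<in> components (V - S \<inter> V) E" "R ` {m..} \<subseteq> C" "Q ` {n..} \<subseteq> C" by blast
  have "V - S \<inter> V = V - S" by auto
  then have C': "C \<in> (V - S) // connected_in (V - S) E" using C(1) by (simp add: components_def)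
  have "(R i, Q j) \<in> connected_in (V - S) E" if "i \<ge> max m n" "j \<ge> max m n" for i j
  proof -
    have "R i \<in> C" "Q j \<in> C" using C(2,3) that by auto
    then show ?thesis using in_quotient_imp_in_rel[OF equiv_connected_in[OF assms(1)] C'] by simp
  qed
  then show ?thesis by blast
qed

theorem theorem5p1:
  fixes V :: "'a set" and E :: "'a \<Rightarrow> 'a \<Rightarrow> bool" and \<omega> :: "(nat \<Rightarrow> 'a) set"
  assumes "simple_graph V E"
    and "one_ended V E"
    and "quasi_transitive V E"
    and "\<omega> \<in> ends V E"
  shows "thick \<omega>"
proof -
  note all = one_ended_end_eq_rays[OF assms(1,2,4)]
  obtain R0 where R0: "R0 \<in> rays V E"
    using assms(4) unfolding ends_def by (auto elim: quotientE)
  interpret one_end V E R0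
  proof
    show "symp E" "\<And>u. \<not> E u u" using assms(1) by (auto simp: simple_graph_def symp_def)
    show "R0 \<in> rays V E" by (rule R0)
    fix Q S assume "Q \<in> rays V E" "finite (S :: 'a set)"
    then show "\<exists>n. \<forall>i\<ge>n. \<forall>j\<ge>n. (Q i, R0 j) \<in> connected_in (V - S) E"
      using equivalent_rays_eventually_connected[OF assms(1) all(2)] R0 by blast
  qed
  have many: "\<exists>F. disjoint_rays_in \<omega> F \<and> finite F \<and> card F = n" for n
    using disjoint_rays_if_infinitely_many_dominating[of n]
      disjoint_rays_if_finitely_many_dominating[OF _ assms(3), of n] all(1) by blast
  have "\<not> has_vertex_degree \<omega> k" for k
  proof
    assume "has_vertex_degree \<omega> k"
    moreover obtain F where "disjoint_rays_in \<omega> F" "card F = Suc k" using many by blast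
    ultimately show False unfolding has_vertex_degree_def by fastforce
  qed
  then show ?thesis by (simp add: thick_def vertex_degree_def)
qed

end
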